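(* Let $Z$ be a Hilbertian ring. Then: (a) If $Z$ is a near UFD, then $Z$ has the Hilbert-Schinzel specialization property for any integers $k,n,s\geq 1$. (b) If $Z$ is a Dedekind domain, then $Z$ has the Hilbert-Schinzel specialization property with $k=1$ and any integers $n,s\geq 1$.
   Context: Let $Z$ be an integral domain with fraction field $Q$. Write $\underline t=(t_1,\ldots,t_k)$, $\underline y=(y_1,\ldots,y_n)$ for tuples of variables. Near UFD: an integral domain $Z$ such that every nonzero element of $Z$ has only finitely many prime divisors (up to multiplication by units), and every element of $Z$ that is not a unit has at least one prime divisor. Hilbertian ring: an integral domain $Z$ whose fraction field $Q$ is of characteristic $0$ or imperfect (i.e. $Q^p\neq Q$ with $p=\mathrm{char}(Q)$) such that the following holds: for all $k,n,s\geq 1$, all polynomials $P_1(\underline t,\underline y),\ldots,P_s(\underline t,\underline y)$ irreducible in $Q[\underline t,\underline y]$ and of degree at least $1$ in $\underline y$, and every nonzero $F(\underline t)\in Q[\underline t]$, there is a $k$-tuple $\underline m\in Z^k$ such that $P_i(\underline m,\underline y)$ is irreducible in $Q[\underline y]$ for each $i=1,\ldots,s$ and $F(\underline m)\neq 0$. Elements of $Z$ are coprime if they have no common divisor other than units. A polynomial with coefficients in $Z$ is primitive with respect to $Z$ if its coefficients are coprime in $Z$ (the zero polynomial is not primitive). A non-unit $a\in Z$, $a\neq 0$, is a fixed divisor of $P(\underline t,\underline y)\in Z[\underline t,\underline y]$ with respect to $\underline t$ if $P(\underline m,\underline y)\equiv 0\pmod a$ for every $\underline m\in Z^k$. Hilbert-Schinzel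 specialization property for integers $k,n,s\geq 1$: for all polynomials $P_1(\underline t,\underline y),\ldots,P_s(\underline t,\underline y)\in Z[\underline t,\underline y]$, irreducible in $Q[\underline t,\underline y]$, primitive with respect to $Z$, of degree $\geq 1$ in $\underline y$, such that $P_1\cdots P_s$ has no fixed divisor in $Z$ with respect to $\underline t$, there is a Zariski-dense subset $H\subset Z^k$ such that for every $\underline m\in H$ the polynomials $P_1(\underline m,\underline y),\ldots,P_s(\underline m,\underline y)$ are irreducible in $Q[\underline y]$ and primitive with respect to $Z$. (Zariski-dense: no nonzero polynomial in $Q[\underline t]$ vanishes on $H$.) *)

theory Defs
  imports
    "HOL-Library.Poly_Mapping"
    "HOL-Library.FuncSet"
    "HOL-Computational_Algebra.Polynomial_Factorial"
    "HOL-Algebra.Algebraic_Closure_Type"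
begin

text \<open>
  The domain \<open>Z\<close> is a type \<open>'a::idom\<close>, its fraction field \<open>Q\<close> is \<open>'a fract\<close>.
  Polynomials have variables indexed by \<^typ>\<open>nat\<close>. In the setting of \<open>k\<close> variables
  \<open>t\<close> and \<open>n\<close> variables \<open>y\<close>, the variables with index in \<open>{..<k}\<close> are the \<open>t\<close>-variables
  and those with index in \<open>{k..<k + n}\<close> are the \<open>y\<close>-variables.
\<close>

type_synonym 'a mpoly = "(nat \<Rightarrow>\<^sub>0 nat) \<Rightarrow>\<^sub>0 'a"

definition mpoly_ring :: "nat set \<Rightarrow> 'a::comm_ring_1 mpoly ring" where
  "mpoly_ring V =
     ring_of_type_algebra\<lparr>carrier := {p. \<forall>\<mu>\<in>Poly_Mapping.keys p. Poly_Mapping.keys \<mu> \<subseteq> V}\<rparr>"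

definition eval_mpoly :: "(nat \<Rightarrow> 'a::comm_ring_1) \<Rightarrow> 'a mpoly \<Rightarrow> 'a" where
  "eval_mpoly m p =
     (\<Sum>\<mu>\<in>Poly_Mapping.keys p. Poly_Mapping.lookup p \<mu> *
        (\<Prod>i\<in>Poly_Mapping.keys \<mu>. m i ^ Poly_Mapping.lookup \<mu> i))"

definition const_mpoly :: "'a::comm_ring_1 \<Rightarrow> 'a mpoly" where
  "const_mpoly c = Poly_Mapping.single 0 c"

definition var_mpoly :: "nat \<Rightarrow> 'a::comm_ring_1 mpoly" where
  "var_mpoly i = Poly_Mapping.single (Poly_Mapping.single i 1) 1"

text \<open>The polynomial \<open>P(m, y)\<close>; it lies in the polynomial ring over \<open>{k..<k + n}\<close>.\<close>

definition specialize :: "nat \<Rightarrow> (nat \<Rightarrow> 'a::comm_ring_1) \<Rightarrow> 'a mpoly \<Rightarrow> 'a mpoly" where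
  "specialize k m p =
     (\<Sum>\<mu>\<in>Poly_Mapping.keys p. const_mpoly (Poly_Mapping.lookup p \<mu>) *
        (\<Prod>i\<in>Poly_Mapping.keys \<mu>.
           (if i < k then const_mpoly (m i) else var_mpoly i) ^ Poly_Mapping.lookup \<mu> i))"

text \<open>Total degree in the \<open>y\<close>-variables (0 for the zero polynomial).\<close>

definition degree_y :: "nat \<Rightarrow> 'a::comm_ring_1 mpoly \<Rightarrow> nat" where
  "degree_y k p =
     Max (insert 0 ((\<lambda>\<mu>. \<Sum>i\<in>{i\<in>Poly_Mapping.keys \<mu>. k \<le> i}. Poly_Mapping.lookup \<mu> i)
       ` Poly_Mapping.keys p))"

abbreviation fract_mpoly :: "'a::idom mpoly \<Rightarrow> 'a fract mpoly" where
  "fract_mpoly p \<equiv> Poly_Mapping.map to_fract p"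

definition tuples :: "nat \<Rightarrow> (nat \<Rightarrow> 'a) set" where
  "tuples k = {..<k} \<rightarrow>\<^sub>E UNIV"

text \<open>The second clause includes \<open>a = 0\<close>, so a field is not a near UFD.\<close>

definition near_ufd :: "'a::idom itself \<Rightarrow> bool" where
  "near_ufd _ \<longleftrightarrow>
     (\<forall>a::'a. a \<noteq> 0 \<longrightarrow>
        (\<exists>S. finite S \<and> (\<forall>p. prime_elem p \<and> p dvd a \<longrightarrow> (\<exists>q\<in>S. \<exists>u. u dvd 1 \<and> p = u * q)))) \<and>
     (\<forall>a::'a. \<not> a dvd 1 \<longrightarrow> (\<exists>p. prime_elem p \<and> p dvd a))"

definition hilbertian_ring :: "'a::idom itself \<Rightarrow> bool" where
  "hilbertian_ring _ \<longleftrightarrow>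
     (CHAR('a fract) = 0 \<or> range (\<lambda>x::'a fract. x ^ CHAR('a fract)) \<noteq> UNIV) \<and>
     (\<forall>k n s. 1 \<le> k \<longrightarrow> 1 \<le> n \<longrightarrow> 1 \<le> s \<longrightarrow>
       (\<forall>(P :: nat \<Rightarrow> 'a fract mpoly) (F :: 'a fract mpoly).
          (\<forall>i<s. P i \<in> carrier (mpoly_ring {..<k + n}) \<and>
                 ring_irreducible\<^bsub>mpoly_ring {..<k + n}\<^esub> (P i) \<and>
                 1 \<le> degree_y k (P i)) \<longrightarrow>
          F \<in> carrier (mpoly_ring {..<k}) \<longrightarrow> F \<noteq> 0 \<longrightarrow>
          (\<exists>m\<in>tuples k :: (nat \<Rightarrow> 'a) set.
             (\<forall>i<s. ring_irreducible\<^bsub>mpoly_ring {k..<k + n}\<^esub>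
                      (specialize k (\<lambda>j. to_fract (m j)) (P i))) \<and>
             eval_mpoly (\<lambda>j. to_fract (m j)) F \<noteq> 0)))"

text \<open>The zero polynomial is not primitive here: all its coefficients are divisible by 0.\<close>

definition primitive_mpoly :: "'a::idom mpoly \<Rightarrow> bool" where
  "primitive_mpoly p \<longleftrightarrow> (\<forall>d. (\<forall>\<mu>. d dvd Poly_Mapping.lookup p \<mu>) \<longrightarrow> d dvd 1)"

definition fixed_divisor :: "nat \<Rightarrow> 'a::idom mpoly \<Rightarrow> 'a \<Rightarrow> bool" where
  "fixed_divisor k p a \<longleftrightarrow>
     a \<noteq> 0 \<and> \<not> a dvd 1 \<and>
     (\<forall>m\<in>tuples k. \<forall>\<mu>. a dvd Poly_Mapping.lookup (specialize k m p) \<mu>)"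

definition zariski_dense :: "nat \<Rightarrow> (nat \<Rightarrow> 'a::idom) set \<Rightarrow> bool" where
  "zariski_dense k H \<longleftrightarrow>
     H \<subseteq> tuples k \<and>
     \<not> (\<exists>F \<in> carrier (mpoly_ring {..<k}) :: 'a fract mpoly set.
          F \<noteq> 0 \<and> (\<forall>m\<in>H. eval_mpoly (\<lambda>j. to_fract (m j)) F = 0))"

definition hilbert_schinzel :: "'a::idom itself \<Rightarrow> nat \<Rightarrow> nat \<Rightarrow> nat \<Rightarrow> bool" where
  "hilbert_schinzel _ k n s \<longleftrightarrow>
     (\<forall>P :: nat \<Rightarrow> 'a mpoly.
        (\<forall>i<s. P i \<in> carrier (mpoly_ring {..<k + n}) \<and>
               ring_irreducible\<^bsub>mpoly_ring {..<k + n}\<^esub> (fract_mpoly (P i)) \<and>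
               primitive_mpoly (P i) \<and>
               1 \<le> degree_y k (P i)) \<longrightarrow>
        \<not> (\<exists>a. fixed_divisor k (\<Prod>i<s. P i) a) \<longrightarrow>
        (\<exists>H. zariski_dense k H \<and>
           (\<forall>m\<in>H. \<forall>i<s.
              ring_irreducible\<^bsub>mpoly_ring {k..<k + n}\<^esub> (fract_mpoly (specialize k m (P i))) \<and>
              primitive_mpoly (specialize k m (P i)))))"

definition integrally_closed :: "'a::idom itself \<Rightarrow> bool" where
  "integrally_closed _ \<longleftrightarrow>
     (\<forall>x::'a fract.
        (\<exists>f::'a poly. lead_coeff f = 1 \<and> poly (map_poly to_fract f) x = 0) \<longrightarrow>
        x \<in> range to_fract)"

text \<open>
  Noetherian, integrally closed, nonzero prime ideals maximal; with this convention fields are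
  Dedekind domains.
\<close>

definition dedekind_domain :: "'a::idom itself \<Rightarrow> bool" where
  "dedekind_domain _ \<longleftrightarrow>
     noetherian_domain (ring_of_type_algebra :: 'a ring) \<and>
     integrally_closed TYPE('a) \<and>
     (\<forall>I. primeideal I (ring_of_type_algebra :: 'a ring) \<and> I \<noteq> {0} \<longrightarrow>
          maximalideal I (ring_of_type_algebra :: 'a ring))"

end

theory Submission
  imports Defs
begin

text \<open>
  Write \<open>G\<close> for the product of the given polynomials \<open>P i\<close> and \<open>t\<close> for the variable that is specialized.

  Since each \<open>P i\<close> is irreducible over the fraction field \<open>Q\<close> and involves a variable other than \<open>t\<close>, the
  coefficients of \<open>G\<close>, taken in \<open>Q[t]\<close>, have no common factor (Gauss). Bezout in \<open>Q[t]\<close>, with denominators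
  cleared, gives a nonzero constant \<open>d\<close> of \<open>Z\<close> that lies, for every \<open>m\<close>, in the ideal generated by the
  coefficients of \<open>G(m)\<close> (\<open>content_contains_constant\<close>). So only the primes above \<open>d\<close> can spoil the
  primitivity of a specialization, and to avoid them is a congruence condition on \<open>m\<close>. Such a condition
  is compatible with Hilbertian specialization: \<open>t \<mapsto> z + a t\<close> is an automorphism over \<open>Q\<close>, so \<open>m\<close> may be
  prescribed modulo any nonzero \<open>a\<close> (\<open>hilbertian_progression\<close>). What remains is to find the right residue
  class.

  Near UFD. Only finitely many primes \<open>p\<close> divide \<open>d\<close>, and none of them divides all values of \<open>G\<close>. The
  Chinese remainder theorem may fail, because distinct primes need not be comaximal; but if \<open>p\<close> does not
  divide \<open>a\<close>, a polynomial with some value outside \<open>(p)\<close> has such a value in each class modulo \<open>a\<close>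
  (\<open>prime_avoid_progression\<close>), and so the primes can be avoided one after the other. For several variables
  \<open>t\<close> the coefficients are coprime but Bezout fails, and the variables are specialized one at a time. What
  must survive each step is that no prime divides all values of \<open>G\<close>. For a prime that does not divide
  \<open>G(m)\<close> and has more residue classes than the degree of \<open>G\<close>, this is automatic
  (\<open>prime_nonvanishing\<close>); the primes with few residue classes are finite in number, since each of them
  divides a difference of two elements of any large enough finite subset of \<open>Z\<close>. So these primes are put
  on the list as well (\<open>near_ufd_specialization_step\<close>).

  Dedekind domain, one variable \<open>t\<close>. Fixed divisors are elements, whereas the content \<open>C(m)\<close>, the ideal
  generated by the coefficients of \<open>G(m)\<close>, is an ideal and may never be trivial. Instead one finds \<open>z\<close> such
  that \<open>C(z)\<close> contains every \<open>C(m)\<close> (\<open>largest_content\<close>). As \<open>d\<close> is in all contents, \<open>C(m)\<close> contains \<open>C(z)\<close>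
  whenever \<open>m\<close> is congruent to \<open>z\<close> modulo \<open>d\<close>. For such an \<open>m\<close>, an element that divides some \<open>P i(m)\<close>
  divides \<open>G(m)\<close>, hence all values of \<open>G\<close>, and the absence of fixed divisors makes it a unit.
\<close>

section \<open>Evaluation homomorphisms of multivariate polynomials\<close>

definition is_ring_hom :: "('a::comm_ring_1 \<Rightarrow> 'b::comm_ring_1) \<Rightarrow> bool" where
  "is_ring_hom h \<longleftrightarrow> h 0 = 0 \<and> h 1 = 1 \<and> (\<forall>x y. h (x + y) = h x + h y) \<and> (\<forall>x y. h (x * y) = h x * h y)"

lemma is_ring_homD:
  assumes "is_ring_hom h"
  shows "h 0 = 0" "h 1 = 1" "h (x + y) = h x + h y" "h (x * y) = h x * h y"
  using assms by (auto simp: is_ring_hom_def)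

lemma is_ring_hom_sum: "is_ring_hom h \<Longrightarrow> h (sum f A) = (\<Sum>x\<in>A. h (f x))"
  by (induction A rule: infinite_finite_induct) (auto simp: is_ring_homD)

lemma is_ring_hom_prod: "is_ring_hom h \<Longrightarrow> h (prod f A) = (\<Prod>x\<in>A. h (f x))"
  by (induction A rule: infinite_finite_induct) (auto simp: is_ring_homD)

lemma is_ring_hom_power: "is_ring_hom h \<Longrightarrow> h (x ^ n) = h x ^ n"
  by (induction n) (auto simp: is_ring_homD)

lemma is_ring_hom_comp: "is_ring_hom g \<Longrightarrow> is_ring_hom h \<Longrightarrow> is_ring_hom (\<lambda>x. g (h x))"
  by (auto simp: is_ring_hom_def)

lemma is_ring_hom_id: "is_ring_hom (\<lambda>x. x)"
  by (auto simp: is_ring_hom_def)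

lemma is_ring_hom_dvd: "is_ring_hom h \<Longrightarrow> x dvd y \<Longrightarrow> h x dvd h y"
  by (auto simp: is_ring_homD elim!: dvdE)

definition monom_eval :: "(nat \<Rightarrow> 'b::comm_ring_1) \<Rightarrow> (nat \<Rightarrow>\<^sub>0 nat) \<Rightarrow> 'b" where
  "monom_eval \<sigma> \<mu> = (\<Prod>i\<in>Poly_Mapping.keys \<mu>. \<sigma> i ^ Poly_Mapping.lookup \<mu> i)"

text \<open>
  The homomorphism that acts on coefficients by \<open>h\<close> and sends the variable \<open>i\<close> to \<open>\<sigma> i\<close>. Evaluation,
  specialization, extension of scalars and changes of variables are all of this form, so that identities
  between them follow from \<open>mp_eval_comp\<close> and a comparison on constants and variables.
\<close>

definition mp_eval :: "('a::comm_ring_1 \<Rightarrow> 'b::comm_ring_1) \<Rightarrow> (nat \<Rightarrow> 'b) \<Rightarrow> 'a mpoly \<Rightarrow> 'b" where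
  "mp_eval h \<sigma> p = (\<Sum>\<mu>\<in>Poly_Mapping.keys p. h (Poly_Mapping.lookup p \<mu>) * monom_eval \<sigma> \<mu>)"

lemma monom_eval_superset:
  assumes "finite A" "Poly_Mapping.keys \<mu> \<subseteq> A"
  shows "monom_eval \<sigma> \<mu> = (\<Prod>i\<in>A. \<sigma> i ^ Poly_Mapping.lookup \<mu> i)"
  unfolding monom_eval_def
  by (rule prod.mono_neutral_left) (use assms in \<open>auto simp: in_keys_iff\<close>)

lemma monom_eval_0 [simp]: "monom_eval \<sigma> 0 = 1"
  by (simp add: monom_eval_def)

lemma monom_eval_single: "monom_eval \<sigma> (Poly_Mapping.single i d) = \<sigma> i ^ d"
  by (cases "d = 0") (auto simp: monom_eval_def)

lemma monom_eval_add: "monom_eval \<sigma> (\<mu> + \<nu>) = monom_eval \<sigma> \<mu> * monom_eval \<sigma> \<nu>"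
proof -
  let ?A = "Poly_Mapping.keys \<mu> \<union> Poly_Mapping.keys \<nu>"
  have "monom_eval \<sigma> (\<mu> + \<nu>) = (\<Prod>i\<in>?A. \<sigma> i ^ Poly_Mapping.lookup (\<mu> + \<nu>) i)"
    by (rule monom_eval_superset) (auto dest: subsetD[OF keys_add])
  also have "\<dots> = (\<Prod>i\<in>?A. \<sigma> i ^ Poly_Mapping.lookup \<mu> i) * (\<Prod>i\<in>?A. \<sigma> i ^ Poly_Mapping.lookup \<nu> i)"
    by (simp add: lookup_add power_add prod.distrib)
  also have "\<dots> = monom_eval \<sigma> \<mu> * monom_eval \<sigma> \<nu>"
    by (subst (1 2) monom_eval_superset[symmetric]) auto
  finally show ?thesis .
qed

lemma mp_eval_superset:
  assumes "is_ring_hom h" "finite A" "Poly_Mapping.keys p \<subseteq> A"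
  shows "mp_eval h \<sigma> p = (\<Sum>\<mu>\<in>A. h (Poly_Mapping.lookup p \<mu>) * monom_eval \<sigma> \<mu>)"
  unfolding mp_eval_def
  by (rule sum.mono_neutral_left) (use assms in \<open>auto simp: in_keys_iff is_ring_homD(1)\<close>)

lemma mp_eval_add:
  assumes "is_ring_hom h"
  shows "mp_eval h \<sigma> (p + q) = mp_eval h \<sigma> p + mp_eval h \<sigma> q"
proof -
  let ?A = "Poly_Mapping.keys p \<union> Poly_Mapping.keys q"
  have "mp_eval h \<sigma> (p + q) = (\<Sum>\<mu>\<in>?A. h (Poly_Mapping.lookup (p + q) \<mu>) * monom_eval \<sigma> \<mu>)"
    by (rule mp_eval_superset) (use assms in \<open>auto dest: subsetD[OF keys_add]\<close>)
  also have "\<dots> = (\<Sum>\<mu>\<in>?A. h (Poly_Mapping.lookup p \<mu>) * monom_eval \<sigma> \<mu>)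
      + (\<Sum>\<mu>\<in>?A. h (Poly_Mapping.lookup q \<mu>) * monom_eval \<sigma> \<mu>)"
    by (simp add: lookup_add is_ring_homD[OF assms] sum.distrib algebra_simps)
  also have "\<dots> = mp_eval h \<sigma> p + mp_eval h \<sigma> q"
    by (subst (1 2) mp_eval_superset[symmetric]) (use assms in auto)
  finally show ?thesis .
qed

lemma mp_eval_0 [simp]: "mp_eval h \<sigma> 0 = 0"
  by (simp add: mp_eval_def)

lemma mp_eval_single: "is_ring_hom h \<Longrightarrow> mp_eval h \<sigma> (Poly_Mapping.single \<mu> c) = h c * monom_eval \<sigma> \<mu>"
  by (cases "c = 0") (auto simp: mp_eval_def is_ring_homD(1))

lemma mpoly_add_induct [case_names zero single add]:
  assumes "P 0" "\<And>\<mu> c. P (Poly_Mapping.single \<mu> c)" "\<And>p q. P p \<Longrightarrow> P q \<Longrightarrow> P (p + q)"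
  shows "P (p :: 'b \<Rightarrow>\<^sub>0 'a::comm_monoid_add)"
proof (induction p rule: update_induct)
  case const
  show ?case by (rule assms(1))
next
  case (update p \<mu> c)
  have "Poly_Mapping.update \<mu> c p = p + Poly_Mapping.single \<mu> c"
    by (rule poly_mapping_eqI)
      (use update in \<open>auto simp: lookup_update lookup_add lookup_single when_def in_keys_iff\<close>)
  then show ?case using assms update by auto
qed

lemma mp_eval_mult:
  assumes h: "is_ring_hom h"
  shows "mp_eval h \<sigma> (p * q) = mp_eval h \<sigma> p * mp_eval h \<sigma> q"
proof (induction p rule: mpoly_add_induct)
  case (single \<mu> c)
  show ?case
    by (induction q rule: mpoly_add_induct)
      (auto simp: mult_single mp_eval_single[OF h] monom_eval_add is_ring_homD[OF h]
        algebra_simps mp_eval_add[OF h])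
qed (auto simp: mp_eval_add[OF h] algebra_simps)

lemma is_ring_hom_mp_eval: "is_ring_hom h \<Longrightarrow> is_ring_hom (mp_eval h \<sigma>)"
  unfolding is_ring_hom_def[of "mp_eval h \<sigma>"]
  using mp_eval_single[of h \<sigma> 0 1]
  by (simp add: mp_eval_add mp_eval_mult is_ring_homD)

lemma is_ring_hom_const: "is_ring_hom const_mpoly"
  by (auto simp: is_ring_hom_def const_mpoly_def single_add mult_single)

lemma is_ring_hom_to_fract: "is_ring_hom to_fract"
  by (auto simp: is_ring_hom_def)

lemma mp_eval_const: "is_ring_hom h \<Longrightarrow> mp_eval h \<sigma> (const_mpoly c) = h c"
  by (simp add: const_mpoly_def mp_eval_single)

lemma mp_eval_var: "is_ring_hom h \<Longrightarrow> mp_eval h \<sigma> (var_mpoly i) = \<sigma> i"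
  by (simp add: var_mpoly_def mp_eval_single monom_eval_single is_ring_homD)

lemma mp_eval_comp:
  assumes "is_ring_hom g"
  shows "g (mp_eval h \<sigma> p) = mp_eval (\<lambda>c. g (h c)) (\<lambda>i. g (\<sigma> i)) p"
  unfolding mp_eval_def monom_eval_def
  by (simp add: is_ring_hom_sum[OF assms] is_ring_hom_prod[OF assms] is_ring_hom_power[OF assms]
      is_ring_homD[OF assms])

section \<open>The variables of a polynomial and irreducibility\<close>

definition mpoly_vars :: "'a::zero mpoly \<Rightarrow> nat set" where
  "mpoly_vars p = (\<Union>\<mu>\<in>Poly_Mapping.keys p. Poly_Mapping.keys \<mu>)"

lemma carrier_mpoly_ring: "p \<in> carrier (mpoly_ring V) \<longleftrightarrow> mpoly_vars p \<subseteq> V"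
  by (auto simp: mpoly_ring_def mpoly_vars_def)

lemma mp_eval_cong:
  assumes "\<And>c. h c = h' c" "\<And>i. i \<in> mpoly_vars p \<Longrightarrow> \<sigma> i = \<sigma>' i"
  shows "mp_eval h \<sigma> p = mp_eval h' \<sigma>' p"
proof -
  have "\<sigma> i = \<sigma>' i" if "\<mu> \<in> Poly_Mapping.keys p" "i \<in> Poly_Mapping.keys \<mu>" for \<mu> i
    using assms(2) that by (auto simp: mpoly_vars_def)
  then show ?thesis
    unfolding mp_eval_def monom_eval_def
    by (intro sum.cong refl arg_cong2[of _ _ _ _ "(*)"] prod.cong) (auto simp: assms(1))
qed

lemma monom_eval_var: "monom_eval var_mpoly \<mu> = Poly_Mapping.single \<mu> (1 :: 'a::comm_ring_1)"
proof (induction \<mu> rule: mpoly_add_induct)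
  case (single i d)
  have "(var_mpoly i :: 'a mpoly) ^ d = Poly_Mapping.single (Poly_Mapping.single i d) 1"
    by (induction d) (auto simp: var_mpoly_def mult_single single_add[symmetric] simp flip: one_poly_mapping_def)
  then show ?case by (simp add: monom_eval_single)
qed (auto simp: monom_eval_add mult_single)

lemma lookup_map_hom: "is_ring_hom h \<Longrightarrow> Poly_Mapping.lookup (Poly_Mapping.map h p) \<mu> = h (Poly_Mapping.lookup p \<mu>)"
  by (auto simp: Poly_Mapping.map.rep_eq when_def is_ring_homD)

lemma mp_eval_hom_const_var:
  assumes "is_ring_hom h"
  shows "mp_eval (\<lambda>c. const_mpoly (h c)) var_mpoly p = Poly_Mapping.map h p"
proof -
  have hom: "is_ring_hom (\<lambda>c. const_mpoly (h c))"
    using is_ring_hom_comp[OF is_ring_hom_const assms] .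
  have map_add: "Poly_Mapping.map h (p + q) = Poly_Mapping.map h p + Poly_Mapping.map h q" for p q :: "'a mpoly"
    by (rule poly_mapping_eqI) (simp add: lookup_map_hom[OF assms] lookup_add is_ring_homD[OF assms])
  show ?thesis
  proof (induction p rule: mpoly_add_induct)
    case zero
    show ?case by (rule poly_mapping_eqI) (simp add: lookup_map_hom[OF assms] is_ring_homD[OF assms])
  next
    case (single \<mu> c)
    show ?case
      by (simp add: mp_eval_single[OF hom] monom_eval_var is_ring_homD[OF assms] Poly_Mapping.map_single)
        (simp add: const_mpoly_def mult_single)
  qed (simp add: mp_eval_add[OF hom] map_add)
qed

lemma mp_eval_const_var: "mp_eval const_mpoly var_mpoly p = p"
  using mp_eval_hom_const_var[OF is_ring_hom_id, of p] lookup_map_hom[OF is_ring_hom_id, of p]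
  by (auto intro: poly_mapping_eqI)

lemma is_ring_hom_map:
  assumes "is_ring_hom h"
  shows "is_ring_hom (Poly_Mapping.map h :: 'a::comm_ring_1 mpoly \<Rightarrow> _)"
  using is_ring_hom_mp_eval[OF is_ring_hom_comp[OF is_ring_hom_const assms], of var_mpoly]
  by (simp add: mp_eval_hom_const_var[OF assms, abs_def])

lemma eval_mpoly_conv: "eval_mpoly m = mp_eval (\<lambda>c. c) m"
  by (auto simp: eval_mpoly_def mp_eval_def monom_eval_def)

lemma specialize_conv:
  "specialize k m = mp_eval const_mpoly (\<lambda>i. if i < k then const_mpoly (m i) else var_mpoly i)"
  by (auto simp: specialize_def mp_eval_def monom_eval_def)

lemma is_ring_hom_specialize: "is_ring_hom (specialize k m)"
  unfolding specialize_conv by (rule is_ring_hom_mp_eval[OF is_ring_hom_const])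

lemma is_ring_hom_eval_mpoly: "is_ring_hom (eval_mpoly m)"
  unfolding eval_mpoly_conv by (rule is_ring_hom_mp_eval[OF is_ring_hom_id])

lemma mpoly_vars_add: "mpoly_vars (p + q) \<subseteq> mpoly_vars p \<union> mpoly_vars q"
  using keys_add[of p q] by (auto simp: mpoly_vars_def)

lemma mpoly_vars_sum: "(\<And>x. x \<in> A \<Longrightarrow> mpoly_vars (f x) \<subseteq> V) \<Longrightarrow> mpoly_vars (sum f A) \<subseteq> V"
  by (induction A rule: infinite_finite_induct)
    (auto simp: mpoly_vars_def[of 0] dest!: subsetD[OF mpoly_vars_add])

lemma mpoly_vars_mult: "mpoly_vars (p * q) \<subseteq> mpoly_vars p \<union> mpoly_vars (q :: 'a::comm_ring_1 mpoly)"
proof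
  fix i assume "i \<in> mpoly_vars (p * q)"
  then obtain \<mu> where \<mu>: "\<mu> \<in> Poly_Mapping.keys (p * q)" "i \<in> Poly_Mapping.keys \<mu>"
    by (auto simp: mpoly_vars_def)
  from \<mu>(1) obtain a b where "\<mu> = a + b" "a \<in> Poly_Mapping.keys p" "b \<in> Poly_Mapping.keys q"
    using keys_mult[of p q] by auto
  then show "i \<in> mpoly_vars p \<union> mpoly_vars q"
    using \<mu>(2) keys_add[of a b] by (auto simp: mpoly_vars_def)
qed

lemma mpoly_vars_one [simp]: "mpoly_vars 1 = {}"
  by (auto simp: mpoly_vars_def)

lemma mpoly_vars_zero [simp]: "mpoly_vars 0 = {}"
  by (auto simp: mpoly_vars_def)

lemma mpoly_vars_prod: "(\<And>x. x \<in> A \<Longrightarrow> mpoly_vars (f x) \<subseteq> V) \<Longrightarrow> mpoly_vars (prod f A :: 'a::comm_ring_1 mpoly) \<subseteq> V"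
proof (induction A rule: infinite_finite_induct)
  case (insert x F)
  then show ?case using mpoly_vars_mult[of "f x" "prod f F"] by (simp, blast)
qed auto

lemma mpoly_vars_power: "mpoly_vars p \<subseteq> V \<Longrightarrow> mpoly_vars (p ^ n :: 'a::comm_ring_1 mpoly) \<subseteq> V"
  using mpoly_vars_prod[of "{..<n}" "\<lambda>_. p"] by simp

lemma mpoly_vars_const [simp]: "mpoly_vars (const_mpoly c) = {}"
  by (cases "c = 0") (auto simp: mpoly_vars_def const_mpoly_def)

lemma mpoly_vars_var: "mpoly_vars (var_mpoly i :: 'a::comm_ring_1 mpoly) = {i}"
  by (auto simp: mpoly_vars_def var_mpoly_def)

lemma mpoly_vars_mp_eval:
  assumes "\<And>c. mpoly_vars (h c) \<subseteq> V" "\<And>i. i \<in> mpoly_vars p \<Longrightarrow> mpoly_vars (\<sigma> i) \<subseteq> V"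
  shows "mpoly_vars (mp_eval h \<sigma> p :: 'a::comm_ring_1 mpoly) \<subseteq> V"
  unfolding mp_eval_def monom_eval_def
proof (rule mpoly_vars_sum)
  fix \<mu> assume \<mu>: "\<mu> \<in> Poly_Mapping.keys p"
  have "mpoly_vars (\<Prod>i\<in>Poly_Mapping.keys \<mu>. \<sigma> i ^ Poly_Mapping.lookup \<mu> i) \<subseteq> V"
    by (intro mpoly_vars_prod mpoly_vars_power assms) (use \<mu> in \<open>auto simp: mpoly_vars_def\<close>)
  then show "mpoly_vars (h (Poly_Mapping.lookup p \<mu>) * (\<Prod>i\<in>Poly_Mapping.keys \<mu>. \<sigma> i ^ Poly_Mapping.lookup \<mu> i)) \<subseteq> V"
    using mpoly_vars_mult assms(1) by blast
qed

lemma mpoly_vars_mult_idom: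
  fixes p q :: "'a::idom mpoly"
  assumes "p \<noteq> 0" "q \<noteq> 0"
  shows "mpoly_vars (p * q) = mpoly_vars p \<union> mpoly_vars q"
proof
  show "mpoly_vars (p * q) \<subseteq> mpoly_vars p \<union> mpoly_vars q" by (rule mpoly_vars_mult)
  have *: "i \<in> mpoly_vars (p * q)" if "p \<noteq> 0" "q \<noteq> 0" "i \<in> mpoly_vars p" for i and p q :: "'a mpoly"
  proof -
    \<comment> \<open>The part of top degree in the variable \<open>i\<close> is multiplicative: the product of the two top parts is
      nonzero, and no other contribution has a monomial of that degree in \<open>i\<close>.\<close>
    define w where "w r = Max ((\<lambda>\<mu>. Poly_Mapping.lookup \<mu> i) ` Poly_Mapping.keys r)" for r :: "'a mpoly"
    have w_le: "Poly_Mapping.lookup \<mu> i \<le> w r" if "\<mu> \<in> Poly_Mapping.keys r" for \<mu> r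
      using that by (auto simp: w_def)
    have w_ex: "\<exists>\<mu>\<in>Poly_Mapping.keys r. Poly_Mapping.lookup \<mu> i = w r" if "r \<noteq> 0" for r
    proof -
      have "w r \<in> (\<lambda>\<mu>. Poly_Mapping.lookup \<mu> i) ` Poly_Mapping.keys r"
        unfolding w_def by (rule Max_in) (use that in auto)
      then show ?thesis by auto
    qed
    define top where "top r = Poly_Mapping.mapp (\<lambda>\<mu> c. if Poly_Mapping.lookup \<mu> i = w r then c else 0) r" for r
    have lookup_top: "Poly_Mapping.lookup (top r) \<mu> = (if Poly_Mapping.lookup \<mu> i = w r then Poly_Mapping.lookup r \<mu> else 0)" for r \<mu>
      by (auto simp: top_def lookup_mapp when_def in_keys_iff)
    have top_nz: "top r \<noteq> 0" if r: "r \<noteq> 0" for r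
    proof -
      obtain \<mu> where "\<mu> \<in> Poly_Mapping.keys r" "Poly_Mapping.lookup \<mu> i = w r" using w_ex[OF r] by auto
      then have "Poly_Mapping.lookup (top r) \<mu> \<noteq> 0" by (simp add: lookup_top in_keys_iff)
      then show ?thesis by auto
    qed
    have "top p * top q \<noteq> 0" using top_nz that by auto
    then obtain \<nu> where \<nu>: "\<nu> \<in> Poly_Mapping.keys (top p * top q)" by (metis keys_eq_empty equals0I)
    then obtain a b where ab: "\<nu> = a + b" "a \<in> Poly_Mapping.keys (top p)" "b \<in> Poly_Mapping.keys (top q)"
      using keys_mult[of "top p" "top q"] by auto
    have "Poly_Mapping.lookup \<nu> i = w p + w q"
      using ab by (auto simp: lookup_add in_keys_iff lookup_top split: if_splits)
    have low: "Poly_Mapping.lookup \<mu> i < w r" if "\<mu> \<in> Poly_Mapping.keys (r - top r)" for r \<mu>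
      using that w_le[of \<mu> r] by (auto simp: in_keys_iff lookup_minus lookup_top split: if_splits)
    have eq: "p * q = top p * top q + ((p - top p) * q + top p * (q - top q))"
      by (simp add: algebra_simps)
    have n1: "\<nu> \<notin> Poly_Mapping.keys ((p - top p) * q)"
    proof
      assume "\<nu> \<in> Poly_Mapping.keys ((p - top p) * q)"
      then obtain a b where "\<nu> = a + b" "a \<in> Poly_Mapping.keys (p - top p)" "b \<in> Poly_Mapping.keys q"
        using keys_mult[of "p - top p" q] by auto
      then have "Poly_Mapping.lookup \<nu> i < w p + w q"
        using low[of a p] w_le[of b q] by (simp add: lookup_add)
      then show False using \<open>Poly_Mapping.lookup \<nu> i = w p + w q\<close> by simp
    qed
    have n2: "\<nu> \<notin> Poly_Mapping.keys (top p * (q - top q))"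
    proof
      assume "\<nu> \<in> Poly_Mapping.keys (top p * (q - top q))"
      then obtain a b where "\<nu> = a + b" "a \<in> Poly_Mapping.keys (top p)" "b \<in> Poly_Mapping.keys (q - top q)"
        using keys_mult[of "top p" "q - top q"] by auto
      moreover from this have "a \<in> Poly_Mapping.keys p" by (auto simp: in_keys_iff lookup_top split: if_splits)
      ultimately have "Poly_Mapping.lookup \<nu> i < w p + w q"
        using low[of b q] w_le[of a p] by (simp add: lookup_add)
      then show False using \<open>Poly_Mapping.lookup \<nu> i = w p + w q\<close> by simp
    qed
    have "\<nu> \<in> Poly_Mapping.keys (p * q)"
      using \<nu> n1 n2 by (subst eq) (simp add: in_keys_iff lookup_add)
    moreover have "0 < w p"
    proof -
      obtain \<mu> where "\<mu> \<in> Poly_Mapping.keys p" "i \<in> Poly_Mapping.keys \<mu>" using \<open>i \<in> mpoly_vars p\<close> by (auto simp: mpoly_vars_def)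
      then show ?thesis using w_le[of \<mu> p] by (auto simp: in_keys_iff)
    qed
    ultimately show ?thesis
      using \<open>Poly_Mapping.lookup \<nu> i = w p + w q\<close> by (auto simp: mpoly_vars_def in_keys_iff intro!: bexI[of _ \<nu>])
  qed
  show "mpoly_vars p \<union> mpoly_vars q \<subseteq> mpoly_vars (p * q)"
    using *[of p q] *[of q p] assms by (auto simp: mult.commute)
qed

text \<open>
  A factor of a nonzero polynomial involves no further variables, so irreducibility does not depend on the
  set of variables of the ambient ring. In particular a polynomial in the variables from \<open>j\<close> on may be
  regarded as a polynomial in all variables, which is what allows a Hilbertian ring to be used for a
  single variable \<open>j\<close> without renaming variables.
\<close>

lemma ring_irreducible_mpoly_ring:
  fixes p :: "'a::idom mpoly"
  assumes p: "mpoly_vars p \<subseteq> V"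
  shows "ring_irreducible\<^bsub>mpoly_ring V\<^esub> p \<longleftrightarrow> Factorial_Ring.irreducible p"
proof -
  have simps: "\<zero>\<^bsub>mpoly_ring V\<^esub> = (0::'a mpoly)" "\<one>\<^bsub>mpoly_ring V\<^esub> = (1::'a mpoly)"
     "x \<otimes>\<^bsub>mpoly_ring V\<^esub> y = x * y" for x y :: "'a mpoly"
    by (auto simp: mpoly_ring_def ring_of_type_algebra_def)
  have fac: "mpoly_vars a \<subseteq> V" "mpoly_vars b \<subseteq> V" if "r = a * b" "r \<noteq> 0" "mpoly_vars r \<subseteq> V" for r a b :: "'a mpoly"
    using that mpoly_vars_mult_idom[of a b] by auto
  have units: "x \<in> Units (mpoly_ring V) \<longleftrightarrow> x dvd 1" for x :: "'a mpoly"
  proof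
    assume "x dvd 1"
    then obtain y where y: "1 = x * y" by (auto elim: dvdE)
    with fac[OF y] show "x \<in> Units (mpoly_ring V)"
      by (auto simp: Units_def carrier_mpoly_ring simps mult.commute intro!: exI[of _ y])
  next
    assume "x \<in> Units (mpoly_ring V)"
    then show "x dvd 1" by (auto simp: Units_def simps) (metis dvd_triv_left)
  qed
  have div: "x divides\<^bsub>mpoly_ring V\<^esub> y \<longleftrightarrow> x dvd y" if "y \<noteq> 0" "mpoly_vars y \<subseteq> V" for x y :: "'a mpoly"
    using that fac(2)[of y x] by (auto simp: factor_def carrier_mpoly_ring simps dvd_def)
  show ?thesis
  proof
    assume irr: "ring_irreducible\<^bsub>mpoly_ring V\<^esub> p"
    then have nz: "p \<noteq> 0" and nu: "\<not> p dvd 1" and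
       pf: "\<And>b. mpoly_vars b \<subseteq> V \<Longrightarrow> properfactor (mpoly_ring V) b p \<Longrightarrow> b dvd 1"
      unfolding ring_irreducible_def Divisibility.irreducible_def units simps by (auto simp: carrier_mpoly_ring)
    show "Factorial_Ring.irreducible p"
    proof (rule irreducibleI[OF nz nu])
      fix a b assume ab: "p = a * b"
      have v: "mpoly_vars a \<subseteq> V" "mpoly_vars b \<subseteq> V" using fac[OF ab nz p] by auto
      have nz': "a \<noteq> 0" "b \<noteq> 0" using ab nz by auto
      show "a dvd 1 \<or> b dvd 1"
      proof (rule ccontr)
        assume neg: "\<not> ?thesis"
        have "\<not> p dvd a"
        proof
          assume "p dvd a"
          then obtain c where "a = p * c" by (rule dvdE)
          then have "a * (b * c) = a * 1" using ab by (simp add: mult.assoc)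
          then have "b * c = 1" using nz' by (simp only: mult_cancel_left) auto
          then show False using neg by (metis dvd_triv_left)
        qed
        then have "properfactor (mpoly_ring V) a p"
          unfolding properfactor_def using nz p v nz' ab by (simp add: div)
        then show False using pf v neg by blast
      qed
    qed
  next
    assume irr: "Factorial_Ring.irreducible p"
    then have nz: "p \<noteq> 0" and nu: "\<not> p dvd 1" by (auto simp: irreducible_def)
    show "ring_irreducible\<^bsub>mpoly_ring V\<^esub> p"
      unfolding ring_irreducible_def Divisibility.irreducible_def units simps carrier_mpoly_ring
    proof (intro conjI ballI impI nz nu)
      fix b assume "b \<in> carrier (mpoly_ring V)" and pf: "properfactor (mpoly_ring V) b p"
      then have b: "b dvd p" "mpoly_vars b \<subseteq> V" by (auto simp: properfactor_def div nz p carrier_mpoly_ring)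
      then obtain c where c: "p = b * c" by (auto elim: dvdE)
      have "\<not> c dvd 1"
      proof
        assume "c dvd 1"
        then have "b * c dvd b * 1" by (intro mult_dvd_mono) auto
        then show False using pf b nz c by (auto simp: properfactor_def div)
      qed
      then show "b dvd 1" using irreducibleD[OF irr c] by auto
    qed
  qed
qed

lemma degree_y_ge_1: "1 \<le> degree_y k p \<longleftrightarrow> \<not> mpoly_vars p \<subseteq> {..<k}"
proof -
  have "1 \<le> degree_y k p \<longleftrightarrow> (\<exists>\<mu>\<in>Poly_Mapping.keys p. 1 \<le> (\<Sum>i\<in>{i\<in>Poly_Mapping.keys \<mu>. k \<le> i}. Poly_Mapping.lookup \<mu> i))"
    unfolding degree_y_def by (subst Max_ge_iff) auto
  also have "\<dots> \<longleftrightarrow> (\<exists>\<mu>\<in>Poly_Mapping.keys p. \<exists>i\<in>Poly_Mapping.keys \<mu>. k \<le> i)"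
    by (intro bex_cong refl) (auto simp: Suc_le_eq sum_eq_0_iff in_keys_iff neq0_conv[symmetric] simp del: neq0_conv)
  also have "\<dots> \<longleftrightarrow> \<not> mpoly_vars p \<subseteq> {..<k}" by (force simp: mpoly_vars_def not_le)
  finally show ?thesis .
qed

section \<open>One distinguished variable\<close>

definition specialize_var :: "nat \<Rightarrow> 'a::comm_ring_1 \<Rightarrow> 'a mpoly \<Rightarrow> 'a mpoly" where
  "specialize_var j a = mp_eval const_mpoly (\<lambda>i. if i = j then const_mpoly a else var_mpoly i)"

text \<open>
  The polynomial rewritten with coefficients that are univariate polynomials in the variable \<open>j\<close>; the other
  variables keep their names.
\<close>

definition poly_in :: "nat \<Rightarrow> 'a::comm_ring_1 mpoly \<Rightarrow> 'a poly mpoly" where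
  "poly_in j = mp_eval (\<lambda>c. const_mpoly [:c:]) (\<lambda>i. if i = j then const_mpoly [:0, 1:] else var_mpoly i)"

definition poly_in_inv :: "nat \<Rightarrow> 'a::comm_ring_1 poly mpoly \<Rightarrow> 'a mpoly" where
  "poly_in_inv j = mp_eval (\<lambda>f. poly (map_poly const_mpoly f) (var_mpoly j)) var_mpoly"

lemma is_ring_hom_pCons: "is_ring_hom (\<lambda>c. [:c:])"
  by (auto simp: is_ring_hom_def one_pCons)

lemma is_ring_hom_specialize_var: "is_ring_hom (specialize_var j a)"
  unfolding specialize_var_def by (rule is_ring_hom_mp_eval[OF is_ring_hom_const])

lemma is_ring_hom_poly_in: "is_ring_hom (poly_in j)"
  unfolding poly_in_def
  by (rule is_ring_hom_mp_eval[OF is_ring_hom_comp[OF is_ring_hom_const is_ring_hom_pCons]])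

lemma is_ring_hom_poly: "is_ring_hom (\<lambda>f. poly f a)"
  by (auto simp: is_ring_hom_def)

lemma is_ring_hom_map_poly:
  assumes "is_ring_hom h"
  shows "is_ring_hom (map_poly h)"
  unfolding is_ring_hom_def
  by (auto intro!: poly_eqI simp: coeff_map_poly is_ring_homD[OF assms] coeff_mult is_ring_hom_sum[OF assms] map_poly_1)

lemma is_ring_hom_poly_in_inv: "is_ring_hom (poly_in_inv j)"
  unfolding poly_in_inv_def
  by (rule is_ring_hom_mp_eval[OF is_ring_hom_comp[OF is_ring_hom_poly is_ring_hom_map_poly[OF is_ring_hom_const]]])

lemma poly_in_inv_const: "poly_in_inv j (const_mpoly f) = poly (map_poly const_mpoly f) (var_mpoly j)"
  unfolding poly_in_inv_def
  by (rule mp_eval_const[OF is_ring_hom_comp[OF is_ring_hom_poly is_ring_hom_map_poly[OF is_ring_hom_const]]])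

lemma poly_in_inv_var: "poly_in_inv j (var_mpoly i) = var_mpoly i"
  unfolding poly_in_inv_def
  by (rule mp_eval_var[OF is_ring_hom_comp[OF is_ring_hom_poly is_ring_hom_map_poly[OF is_ring_hom_const]]])

lemma const_mpoly_0 [simp]: "const_mpoly 0 = 0" and const_mpoly_1 [simp]: "const_mpoly 1 = 1"
  by (simp_all add: is_ring_homD[OF is_ring_hom_const])

lemma poly_in_inv_poly_in: "poly_in_inv j (poly_in j p) = p"
proof -
  have "poly_in_inv j (poly_in j p) = mp_eval const_mpoly var_mpoly p"
    unfolding poly_in_def mp_eval_comp[OF is_ring_hom_poly_in_inv]
    by (rule mp_eval_cong) (auto simp: poly_in_inv_const poly_in_inv_var map_poly_pCons)
  then show ?thesis by (simp add: mp_eval_const_var)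
qed

text \<open>
  The condition on \<open>\<mu>\<close> records that the variable \<open>j\<close> has moved into the coefficients.
\<close>

lemma coeff_lookup_poly_in:
  "poly.coeff (Poly_Mapping.lookup (poly_in j p) \<mu>) d =
     (if Poly_Mapping.lookup \<mu> j = 0 then Poly_Mapping.lookup p (\<mu> + Poly_Mapping.single j d) else 0)"
proof (induction p rule: mpoly_add_induct)
  case zero
  show ?case by (simp add: is_ring_homD[OF is_ring_hom_poly_in])
next
  case (add p q)
  then show ?case by (simp add: is_ring_homD[OF is_ring_hom_poly_in] lookup_add)
next
  case (single \<kappa> c)
  define e where "e = Poly_Mapping.lookup \<kappa> j"
  define \<nu> where "\<nu> = \<kappa> - Poly_Mapping.single j e"
  have \<nu>j: "Poly_Mapping.lookup \<nu> j = 0" and \<kappa>: "\<kappa> = \<nu> + Poly_Mapping.single j e"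
    by (auto intro!: poly_mapping_eqI simp: \<nu>_def e_def lookup_add Poly_Mapping.lookup_single when_def minus_poly_mapping.rep_eq)
  let ?\<sigma> = "\<lambda>i. if i = j then const_mpoly [:0, 1:] else var_mpoly i :: 'a poly mpoly"
  have "monom_eval ?\<sigma> \<nu> = monom_eval var_mpoly \<nu>"
    unfolding monom_eval_def using \<nu>j by (intro prod.cong) (auto simp: in_keys_iff)
  then have "poly_in j (Poly_Mapping.single \<kappa> c) = const_mpoly [:c:] * Poly_Mapping.single \<nu> 1 * const_mpoly [:0, 1:] ^ e"
    unfolding poly_in_def mp_eval_single[OF is_ring_hom_comp[OF is_ring_hom_const is_ring_hom_pCons]]
    by (subst \<kappa>) (simp add: monom_eval_add monom_eval_single monom_eval_var mult.assoc)
  also have "\<dots> = Poly_Mapping.single \<nu> (Polynomial.monom c e)"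
    by (simp add: monom_altdef mult_single const_mpoly_def
        flip: is_ring_hom_power[OF is_ring_hom_const, unfolded const_mpoly_def])
  finally have eq: "poly_in j (Poly_Mapping.single \<kappa> c) = Poly_Mapping.single \<nu> (Polynomial.monom c e)" .
  have iff: "Poly_Mapping.lookup \<mu> j = 0 \<Longrightarrow> \<kappa> = \<mu> + Poly_Mapping.single j d \<longleftrightarrow> \<nu> = \<mu> \<and> e = d"
  proof -
    assume 0: "Poly_Mapping.lookup \<mu> j = 0"
    show ?thesis
    proof
      assume eq: "\<kappa> = \<mu> + Poly_Mapping.single j d"
      then have "e = d" using 0 by (simp add: e_def lookup_add)
      then show "\<nu> = \<mu> \<and> e = d" using eq \<kappa> by simp
    qed (use \<kappa> in auto)
  qed
  show ?case
    unfolding eq using iff \<nu>j by (auto simp: Poly_Mapping.lookup_single when_def)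
qed

lemma specialize_var_conv_poly_in: "specialize_var j a p = Poly_Mapping.map (\<lambda>f. poly f a) (poly_in j p)"
  unfolding mp_eval_hom_const_var[OF is_ring_hom_poly, symmetric]
  unfolding specialize_var_def poly_in_def
  apply (subst mp_eval_comp[OF is_ring_hom_mp_eval[OF is_ring_hom_comp[OF is_ring_hom_const is_ring_hom_poly]]])
  apply (rule mp_eval_cong)
   apply (auto simp: mp_eval_const[OF is_ring_hom_comp[OF is_ring_hom_const is_ring_hom_poly]]
     mp_eval_var[OF is_ring_hom_comp[OF is_ring_hom_const is_ring_hom_poly]])
  done

lemma lookup_specialize_var: "Poly_Mapping.lookup (specialize_var j a p) \<mu> = poly (Poly_Mapping.lookup (poly_in j p) \<mu>) a"
  by (simp add: specialize_var_conv_poly_in lookup_map_hom[OF is_ring_hom_poly])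

lemma specialize_specialize_var:
  assumes "j < k"
  shows "specialize k m (specialize_var j a p) = specialize k (m(j := a)) p"
  unfolding specialize_var_def mp_eval_comp[OF is_ring_hom_specialize]
  unfolding specialize_conv using assms
  by (intro mp_eval_cong) (auto simp: mp_eval_const[OF is_ring_hom_const] mp_eval_var[OF is_ring_hom_const])

lemma poly_in_nonzero: "p \<noteq> 0 \<Longrightarrow> poly_in j p \<noteq> 0"
  using poly_in_inv_poly_in[of j p] by (auto simp: is_ring_homD(1)[OF is_ring_hom_poly_in_inv])

lemma mpoly_vars_specialize_var: "mpoly_vars (specialize_var j a p) \<subseteq> mpoly_vars p - {j}"
  unfolding specialize_var_def
  by (rule mpoly_vars_mp_eval) (auto simp: mpoly_vars_var)

section \<open>Prime constants\<close>

lemma lookup_const_mult: "Poly_Mapping.lookup (const_mpoly c * f) \<mu> = c * Poly_Mapping.lookup f \<mu>"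
  unfolding const_mpoly_def mult_map_scale_conv_mult[symmetric]
  by (simp add: Poly_Mapping.map.rep_eq when_def)

lemma const_dvd_iff:
  "const_mpoly c dvd f \<longleftrightarrow> (\<forall>\<mu>. c dvd Poly_Mapping.lookup f \<mu>)"
proof
  assume R: "\<forall>\<mu>. c dvd Poly_Mapping.lookup f \<mu>"
  define g where "g = Poly_Mapping.mapp (\<lambda>_ x. SOME y. x = c * y) f"
  have "c * (SOME y. Poly_Mapping.lookup f \<mu> = c * y) = Poly_Mapping.lookup f \<mu>" for \<mu>
    using R someI_ex[of "\<lambda>y. Poly_Mapping.lookup f \<mu> = c * y"] unfolding dvd_def by metis
  then have "f = const_mpoly c * g"
    by (intro poly_mapping_eqI) (auto simp: lookup_const_mult g_def lookup_mapp when_def in_keys_iff)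
  then show "const_mpoly c dvd f" by simp
qed (auto simp: lookup_const_mult elim!: dvdE)

text \<open>
  Gauss's lemma: modulo \<open>p\<close> one may drop all terms with coefficients divisible by \<open>p\<close>, and then the product
  of the leading coefficients, for the monomial order, is the leading coefficient of the product.
\<close>

lemma prime_elem_const_mpoly:
  fixes p :: "'a::idom"
  assumes p: "prime_elem p"
  shows "prime_elem (const_mpoly p)"
proof (rule prime_elemI)
  show "const_mpoly p \<noteq> 0" using p by (metis const_mpoly_def lookup_single_eq lookup_zero prime_elem_not_zeroI)
  show "\<not> const_mpoly p dvd 1" using p
    by (auto simp: const_dvd_iff prime_elem_def intro!: exI[of _ 0])
  fix f g assume dvd: "const_mpoly p dvd f * g"
  show "const_mpoly p dvd f \<or> const_mpoly p dvd g"
  proof (rule ccontr)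
    assume neg: "\<not> ?thesis"
    define B where "B h = {\<mu>\<in>Poly_Mapping.keys h. \<not> p dvd Poly_Mapping.lookup h \<mu>}" for h :: "'a mpoly"
    define m where "m h = Max (B h)" for h
    have fin: "finite (B h)" for h by (simp add: B_def)
    have in_B: "\<mu> \<in> B h \<longleftrightarrow> \<not> p dvd Poly_Mapping.lookup h \<mu>" for h \<mu>
      by (auto simp: B_def in_keys_iff)
    define low where "low h = Poly_Mapping.mapp (\<lambda>\<mu> x. if p dvd x \<or> \<mu> = m h then 0 else x) h" for h
    have lookup_low: "Poly_Mapping.lookup (low h) \<mu> = (if p dvd Poly_Mapping.lookup h \<mu> \<or> \<mu> = m h then 0 else Poly_Mapping.lookup h \<mu>)" for h \<mu>
      by (auto simp: low_def lookup_mapp when_def in_keys_iff)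
    have low: "\<mu> < m h" if "\<mu> \<in> Poly_Mapping.keys (low h)" for \<mu> h
    proof -
      have "\<mu> \<in> B h" "\<mu> \<noteq> m h" using that by (auto simp: in_B in_keys_iff lookup_low split: if_splits)
      then show ?thesis using Max_ge[OF fin, of \<mu> h] by (simp add: m_def)
    qed
    have mB: "m h \<in> B h" if "\<not> const_mpoly p dvd h" for h
      unfolding m_def by (rule Max_in[OF fin]) (use that in \<open>auto simp: const_dvd_iff in_B\<close>)
    \<comment> \<open>Modulo \<open>p\<close>, the polynomial \<open>h\<close> is its leading term \<open>t h\<close> plus the terms \<open>low h\<close> of smaller monomials.\<close>
    define t where "t h = Poly_Mapping.single (m h) (Poly_Mapping.lookup h (m h))" for h
    have cong: "const_mpoly p dvd h - (t h + low h)" if "\<not> const_mpoly p dvd h" for h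
      unfolding const_dvd_iff using mB[OF that]
      by (auto simp: lookup_minus lookup_add lookup_low t_def Poly_Mapping.lookup_single when_def)
    have "f * g - (t f + low f) * (t g + low g) = (f - (t f + low f)) * g + (t f + low f) * (g - (t g + low g))"
      by (simp add: algebra_simps)
    moreover have "const_mpoly p dvd (f - (t f + low f)) * g + (t f + low f) * (g - (t g + low g))"
      using cong neg by (intro dvd_add dvd_mult dvd_mult2) auto
    ultimately have "const_mpoly p dvd (t f + low f) * (t g + low g)"
      using dvd by (metis dvd_diff_right_iff dvd_diffD1 diff_diff_eq2 dvd_diff dvd_add_right_iff diff_add_cancel)
    then have dl: "p dvd Poly_Mapping.lookup ((t f + low f) * (t g + low g)) (m f + m g)"
      by (simp add: const_dvd_iff)
    have eq: "(t f + low f) * (t g + low g) = t f * t g + (low f * (t g + low g) + t f * low g)"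
      by (simp add: algebra_simps)
    have tkeys: "\<mu> \<le> m h" if "\<mu> \<in> Poly_Mapping.keys (t h + low h)" for \<mu> h
      using that keys_add[of "t h" "low h"] low[of \<mu> h] by (auto simp: t_def split: if_splits)
    have z1: "Poly_Mapping.lookup (low f * (t g + low g)) (m f + m g) = 0"
    proof (rule ccontr)
      assume "\<not> ?thesis"
      then have "m f + m g \<in> Poly_Mapping.keys (low f * (t g + low g))" by (simp add: in_keys_iff)
      then obtain a b where "m f + m g = a + b" "a \<in> Poly_Mapping.keys (low f)" "b \<in> Poly_Mapping.keys (t g + low g)"
        using keys_mult[of "low f" "t g + low g"] by auto
      then show False using low[of a f] tkeys[of b g] add_less_le_mono[of a "m f" b "m g"] by auto
    qed
    have z2: "Poly_Mapping.lookup (t f * low g) (m f + m g) = 0"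
    proof (rule ccontr)
      assume "\<not> ?thesis"
      then have "m f + m g \<in> Poly_Mapping.keys (t f * low g)" by (simp add: in_keys_iff)
      then obtain a b where "m f + m g = a + b" "a \<in> Poly_Mapping.keys (t f)" "b \<in> Poly_Mapping.keys (low g)"
        using keys_mult[of "t f" "low g"] by auto
      then show False using low[of b g] by (auto simp: t_def split: if_splits)
    qed
    have "p dvd Poly_Mapping.lookup f (m f) * Poly_Mapping.lookup g (m g)"
      using dl unfolding eq by (simp add: lookup_add z1 z2) (simp add: t_def mult_single)
    then show False using prime_elem_dvd_multD[OF p] mB[of f] mB[of g] neg by (auto simp: in_B)
  qed
qed

section \<open>Hilbertian specialization in an arithmetic progression\<close>

definition affine :: "nat \<Rightarrow> 'a::comm_ring_1 \<Rightarrow> 'a \<Rightarrow> 'a mpoly \<Rightarrow> 'a mpoly" where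
  "affine j u v = mp_eval const_mpoly
     (\<lambda>i. if i = j then const_mpoly u + const_mpoly v * var_mpoly j else var_mpoly i)"

lemma is_ring_hom_affine: "is_ring_hom (affine j u v)"
  unfolding affine_def by (rule is_ring_hom_mp_eval[OF is_ring_hom_const])

lemma affine_const: "affine j u v (const_mpoly c) = const_mpoly c"
  and affine_var: "affine j u v (var_mpoly i) = (if i = j then const_mpoly u + const_mpoly v * var_mpoly j else var_mpoly i)"
  unfolding affine_def by (simp_all add: mp_eval_const[OF is_ring_hom_const] mp_eval_var[OF is_ring_hom_const])

lemma affine_affine:
  assumes "v * v' = 1" "u + v * u' = 0"
  shows "affine j u' v' (affine j u v p) = p"
proof -
  have "const_mpoly u + const_mpoly v * (const_mpoly u' + const_mpoly v' * var_mpoly j)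
       = const_mpoly (u + v * u') + const_mpoly (v * v') * var_mpoly j"
    by (simp add: is_ring_homD[OF is_ring_hom_const] algebra_simps)
  also have "\<dots> = var_mpoly j" by (simp add: assms)
  finally have *: "const_mpoly u + const_mpoly v * (const_mpoly u' + const_mpoly v' * var_mpoly j) = var_mpoly j" .
  have "affine j u' v' (affine j u v p) = mp_eval const_mpoly var_mpoly p"
    unfolding affine_def[of j u v] mp_eval_comp[OF is_ring_hom_affine]
    by (rule mp_eval_cong) (auto simp: is_ring_homD[OF is_ring_hom_affine] affine_const affine_var *)
  then show ?thesis by (simp add: mp_eval_const_var)
qed

lemma mpoly_vars_affine: "mpoly_vars (affine j u v p) \<subseteq> mpoly_vars p"
  unfolding affine_def
proof (rule mpoly_vars_mp_eval)
  fix i assume "i \<in> mpoly_vars p"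
  then show "mpoly_vars (if i = j then const_mpoly u + const_mpoly v * var_mpoly j else var_mpoly i) \<subseteq> mpoly_vars p"
    using mpoly_vars_add[of "const_mpoly u" "const_mpoly v * var_mpoly j"] mpoly_vars_mult[of "const_mpoly v" "var_mpoly j"]
    by (auto simp: mpoly_vars_var)
qed auto

lemma irreducible_hom_inverse:
  assumes g: "is_ring_hom g" and h: "is_ring_hom h"
    and gh: "\<And>x. g (h x) = x" and hg: "\<And>x. h (g x) = x"
    and irr: "Factorial_Ring.irreducible p"
  shows "Factorial_Ring.irreducible (g p)"
proof (rule irreducibleI)
  show "g p \<noteq> 0" using irr hg[of p] is_ring_homD(1)[OF h] by (auto simp: irreducible_def)
  have unit: "x dvd 1" if "h x dvd 1" for x
    using is_ring_hom_dvd[OF g that] by (simp add: gh is_ring_homD[OF g])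
  show "\<not> g p dvd 1"
    using is_ring_hom_dvd[OF h, of "g p" 1] irr by (auto simp: hg is_ring_homD[OF h] irreducible_def)
  fix a b assume "g p = a * b"
  then have "p = h a * h b" using hg[of p] by (simp add: is_ring_homD[OF h])
  then show "a dvd 1 \<or> b dvd 1" using irreducibleD[OF irr] unit by blast
qed

lemma fract_mpoly_specialize_var: "fract_mpoly (specialize_var j m p) = specialize_var j (to_fract m) (fract_mpoly p)"
proof -
  note hm = is_ring_hom_map[OF is_ring_hom_to_fract]
  have c: "fract_mpoly (const_mpoly c) = const_mpoly (to_fract c)" for c :: 'a
    by (simp add: const_mpoly_def Poly_Mapping.map_single)
  have v: "fract_mpoly (var_mpoly i :: 'a mpoly) = var_mpoly i" for i
    by (simp add: var_mpoly_def Poly_Mapping.map_single)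
  note hom = is_ring_hom_comp[OF is_ring_hom_const is_ring_hom_to_fract]
  have "fract_mpoly (specialize_var j m p) = mp_eval (\<lambda>c. const_mpoly (to_fract c)) (\<lambda>i. if i = j then const_mpoly (to_fract m) else var_mpoly i) p"
    unfolding specialize_var_def mp_eval_comp[OF hm] by (rule mp_eval_cong) (auto simp: c v)
  also have "\<dots> = specialize_var j (to_fract m) (fract_mpoly p)"
    unfolding mp_eval_hom_const_var[OF is_ring_hom_to_fract, symmetric] mp_eval_comp[OF is_ring_hom_specialize_var]
    by (rule mp_eval_cong)
      (auto simp: specialize_var_def mp_eval_const[OF is_ring_hom_const] mp_eval_var[OF is_ring_hom_const])
  finally show ?thesis .
qed

lemma keys_fract [simp]: "Poly_Mapping.keys (fract_mpoly p) = Poly_Mapping.keys p"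
  by (rule Set.set_eqI) (simp add: in_keys_iff lookup_map_hom[OF is_ring_hom_to_fract])

lemma mpoly_vars_fract [simp]: "mpoly_vars (fract_mpoly p) = mpoly_vars p"
  by (simp add: mpoly_vars_def)

lemma hom_poly_map_poly:
  assumes g: "is_ring_hom g" and h: "is_ring_hom h"
  shows "g (poly (map_poly h f) x) = poly (map_poly (\<lambda>c. g (h c)) f) (g x)"
  by (induction f) (auto simp: map_poly_pCons is_ring_homD[OF g] is_ring_homD[OF h])

lemma poly_map_poly_pCons_X: "poly (map_poly (\<lambda>c. [:c:]) f) [:0, 1:] = (f :: 'a::comm_ring_1 poly)"
  by (induction f) (auto simp: map_poly_pCons)

lemma poly_in_const: "poly_in j (const_mpoly c) = const_mpoly [:c:]"
  and poly_in_var: "poly_in j (var_mpoly i) = (if i = j then const_mpoly [:0, 1:] else var_mpoly i)"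
  unfolding poly_in_def
  by (simp_all add: mp_eval_const[OF is_ring_hom_comp[OF is_ring_hom_const is_ring_hom_pCons]]
      mp_eval_var[OF is_ring_hom_comp[OF is_ring_hom_const is_ring_hom_pCons]])

lemma poly_in_poly_in_inv_const: "poly_in j (poly_in_inv j (const_mpoly f)) = const_mpoly f"
proof -
  have "poly_in j (poly_in_inv j (const_mpoly f)) = poly (map_poly (\<lambda>c. const_mpoly [:c:]) f) (const_mpoly [:0, 1:])"
    unfolding poly_in_inv_const hom_poly_map_poly[OF is_ring_hom_poly_in is_ring_hom_const]
    by (simp add: poly_in_const poly_in_var)
  also have "\<dots> = const_mpoly (poly (map_poly (\<lambda>c. [:c:]) f) [:0, 1:])"
    by (rule hom_poly_map_poly[OF is_ring_hom_const is_ring_hom_pCons, symmetric])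
  finally show ?thesis by (simp add: poly_map_poly_pCons_X)
qed

lemma mpoly_vars_poly_in_inv_const: "mpoly_vars (poly_in_inv j (const_mpoly f)) \<subseteq> {j}"
proof (induction f)
  case (pCons a f)
  let ?q = "poly (map_poly const_mpoly f) (var_mpoly j)"
  have "mpoly_vars (const_mpoly a + var_mpoly j * ?q) \<subseteq> mpoly_vars (const_mpoly a) \<union> (mpoly_vars (var_mpoly j :: 'a mpoly) \<union> mpoly_vars ?q)"
    using mpoly_vars_add mpoly_vars_mult by blast
  then show ?case using pCons
    by (auto simp: poly_in_inv_const map_poly_pCons mpoly_vars_var)
qed (simp add: is_ring_homD(1)[OF is_ring_hom_poly_in_inv])

lemma const_mpoly_eq_0_iff [simp]: "const_mpoly c = 0 \<longleftrightarrow> c = 0"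
  by (metis const_mpoly_0 const_mpoly_def lookup_single_eq lookup_zero)

lemma specialize_affine:
  assumes "mpoly_vars p \<subseteq> {j..}"
  shows "specialize (Suc j) m (affine j u v p) = specialize_var j (u + v * m j) p"
  unfolding affine_def mp_eval_comp[OF is_ring_hom_specialize]
  unfolding specialize_conv specialize_var_def
proof (rule mp_eval_cong, goal_cases)
  case (2 i)
  then have "j \<le> i" using assms by auto
  then show ?case
    by (auto simp: is_ring_homD[OF is_ring_hom_mp_eval[OF is_ring_hom_const]] is_ring_homD[OF is_ring_hom_const]
        mp_eval_const[OF is_ring_hom_const] mp_eval_var[OF is_ring_hom_const])
qed (simp add: mp_eval_const[OF is_ring_hom_const])

lemma eval_affine_poly_in_inv_const:
  "eval_mpoly m (affine j u v (poly_in_inv j (const_mpoly f))) = poly f (u + v * m j)"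
proof -
  note he = is_ring_hom_comp[OF is_ring_hom_eval_mpoly is_ring_hom_affine]
  have ec: "eval_mpoly m (const_mpoly c) = c" for c :: 'a
    unfolding eval_mpoly_conv by (rule mp_eval_const[OF is_ring_hom_id])
  have ev: "eval_mpoly m (var_mpoly i) = m i" for i
    unfolding eval_mpoly_conv by (rule mp_eval_var[OF is_ring_hom_id])
  show ?thesis
    unfolding poly_in_inv_const hom_poly_map_poly[OF he is_ring_hom_const]
    by (simp add: affine_const affine_var ec ev is_ring_homD[OF is_ring_hom_eval_mpoly] map_poly_idI)
qed

text \<open>
  The substitution \<open>t \<mapsto> z + a t\<close> in the variable \<open>t\<close> of index \<open>j\<close> is an automorphism over the fraction
  field, because \<open>a\<close> is invertible there. A Hilbertian specialization of the transformed polynomials is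
  therefore a specialization of the original ones at a point of the progression \<open>z + a Z\<close>.
\<close>

lemma hilbertian_progression:
  fixes R :: "nat \<Rightarrow> 'z::idom mpoly" and f :: "'z fract poly"
  assumes hilb: "hilbertian_ring TYPE('z)"
    and s: "1 \<le> s" and jN: "Suc j < N"
    and vars: "\<And>i. i < s \<Longrightarrow> mpoly_vars (R i) \<subseteq> {j..<N}"
    and irr: "\<And>i. i < s \<Longrightarrow> Factorial_Ring.irreducible (fract_mpoly (R i))"
    and high: "\<And>i. i < s \<Longrightarrow> \<not> mpoly_vars (R i) \<subseteq> {..j}"
    and f: "f \<noteq> 0" and a: "a \<noteq> 0"
  obtains m where "a dvd m - z" "poly f (to_fract m) \<noteq> 0"
    "\<And>i. i < s \<Longrightarrow> Factorial_Ring.irreducible (fract_mpoly (specialize_var j m (R i)))"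
proof -
  define u where "u = to_fract z"
  define v where "v = to_fract a"
  have v: "v \<noteq> 0" using a by (simp add: v_def)
  define T where "T = affine j u v"
  define T' where "T' = affine j (- u / v) (1 / v)"
  have TT': "T (T' p) = p" and T'T: "T' (T p) = p" for p
    unfolding T_def T'_def using v by (auto intro!: affine_affine)
  have hT: "is_ring_hom T" "is_ring_hom T'" by (auto simp: T_def T'_def is_ring_hom_affine)
  define P where "P i = T (fract_mpoly (R i))" for i
  define F where "F = T (poly_in_inv j (const_mpoly f))"
  have Pvars: "mpoly_vars (P i) \<subseteq> {j..<N}" if "i < s" for i
    using mpoly_vars_affine[of j u v "fract_mpoly (R i)"] vars[OF that] by (auto simp: P_def T_def)
  have Fnz: "F \<noteq> 0"
  proof
    assume "F = 0"
    then have "poly_in j (T' F) = 0" by (simp add: is_ring_homD[OF hT(2)] is_ring_homD[OF is_ring_hom_poly_in])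
    then show False using f by (simp add: F_def T'T poly_in_poly_in_inv_const)
  qed
  have Fvars: "mpoly_vars F \<subseteq> {..<Suc j}"
    using mpoly_vars_affine[of j u v "poly_in_inv j (const_mpoly f)"] mpoly_vars_poly_in_inv_const[of j f]
    by (auto simp: F_def T_def)
  have N: "Suc j + (N - Suc j) = N" "1 \<le> N - Suc j" using jN by auto
  have cond: "P i \<in> carrier (mpoly_ring {..<N}) \<and>
      ring_irreducible\<^bsub>mpoly_ring {..<N}\<^esub> (P i) \<and> 1 \<le> degree_y (Suc j) (P i)" if i: "i < s" for i
  proof (intro conjI)
    show c: "P i \<in> carrier (mpoly_ring {..<N})" using Pvars[OF i] by (auto simp: carrier_mpoly_ring)
    have "Factorial_Ring.irreducible (P i)"
      unfolding P_def by (rule irreducible_hom_inverse[OF hT TT' T'T irr[OF i]])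
    then show "ring_irreducible\<^bsub>mpoly_ring {..<N}\<^esub> (P i)"
      using c by (simp add: ring_irreducible_mpoly_ring carrier_mpoly_ring)
    show "1 \<le> degree_y (Suc j) (P i)"
      unfolding degree_y_ge_1
    proof
      assume "mpoly_vars (P i) \<subseteq> {..<Suc j}"
      then have "mpoly_vars (T' (P i)) \<subseteq> {..<Suc j}"
        using mpoly_vars_affine[of j "- u / v" "1 / v" "P i"] by (auto simp: T'_def)
      then show False using high[OF i] by (simp add: P_def T'T lessThan_Suc_atMost)
    qed
  qed
  \<comment> \<open>The variables \<open>0, ..., j\<close> are specialized together; the polynomials involve only \<open>j\<close> among them.\<close>
  obtain m :: "nat \<Rightarrow> 'z" where
    mi: "\<And>i. i < s \<Longrightarrow> ring_irreducible\<^bsub>mpoly_ring {Suc j..<N}\<^esub> (specialize (Suc j) (\<lambda>i. to_fract (m i)) (P i))"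
    and mF: "eval_mpoly (\<lambda>i. to_fract (m i)) F \<noteq> 0"
    using hilb[unfolded hilbertian_ring_def, THEN conjunct2, rule_format, of "Suc j" "N - Suc j" s P F, unfolded N]
      cond Fnz Fvars s N by (auto simp: carrier_mpoly_ring)
  define x where "x = z + a * m j"
  have x: "u + v * to_fract (m j) = to_fract x" by (simp add: x_def u_def v_def)
  show thesis
  proof
    show "a dvd x - z" by (simp add: x_def)
    show "poly f (to_fract x) \<noteq> 0"
      using mF by (simp add: F_def T_def eval_affine_poly_in_inv_const x)
    fix i assume i: "i < s"
    have eq: "specialize (Suc j) (\<lambda>i. to_fract (m i)) (P i) = fract_mpoly (specialize_var j x (R i))"
      unfolding P_def T_def fract_mpoly_specialize_var x[symmetric]
      by (rule specialize_affine) (use vars[OF i] in auto)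
    have "mpoly_vars (specialize_var j x (R i)) \<subseteq> {Suc j..<N}"
      using mpoly_vars_specialize_var[of j x "R i"] vars[OF i] by fastforce
    then show "Factorial_Ring.irreducible (fract_mpoly (specialize_var j x (R i)))"
      using mi[OF i] unfolding eq by (simp add: ring_irreducible_mpoly_ring)
  qed
qed

section \<open>A constant in the content of every specialization\<close>

lemma lookup_poly_in_fract: "Poly_Mapping.lookup (poly_in j (fract_mpoly p)) \<mu> = map_poly to_fract (Poly_Mapping.lookup (poly_in j p) \<mu>)"
  by (rule poly_eqI) (simp add: coeff_lookup_poly_in coeff_map_poly lookup_map_hom[OF is_ring_hom_to_fract])

text \<open>
  An element of least degree in the ideal of \<open>Z[t]\<close> generated by the coefficients divides all of them over
  the fraction field, by pseudo-division. It must be constant, as there is no common factor.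
\<close>

lemma const_in_content_ideal:
  fixes G :: "'a::idom mpoly"
  assumes nz: "G \<noteq> 0"
    and no: "\<And>g :: 'a fract poly. 1 \<le> Polynomial.degree g \<Longrightarrow> \<not> const_mpoly g dvd poly_in j (fract_mpoly G)"
  obtains d V where "d \<noteq> 0"
    "[:d:] = (\<Sum>\<mu>\<in>Poly_Mapping.keys (poly_in j G). V \<mu> * Poly_Mapping.lookup (poly_in j G) \<mu>)"
proof -
  let ?K = "Poly_Mapping.keys (poly_in j G)" and ?c = "Poly_Mapping.lookup (poly_in j G)"
  define J where "J = range (\<lambda>V. \<Sum>\<mu>\<in>?K. V \<mu> * ?c \<mu>)"
  have JI: "(\<Sum>\<mu>\<in>?K. V \<mu> * ?c \<mu>) \<in> J" for V by (auto simp: J_def)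
  have J_lin: "x * f + y * g \<in> J" if fg: "f \<in> J" "g \<in> J" for f g x y
  proof -
    obtain V W where "f = (\<Sum>\<mu>\<in>?K. V \<mu> * ?c \<mu>)" "g = (\<Sum>\<mu>\<in>?K. W \<mu> * ?c \<mu>)"
      using fg by (auto simp: J_def)
    then have "x * f + y * g = (\<Sum>\<mu>\<in>?K. (x * V \<mu> + y * W \<mu>) * ?c \<mu>)"
      by (simp add: sum_distrib_left sum.distrib algebra_simps)
    then show ?thesis using JI by simp
  qed
  have Jc: "?c \<mu> \<in> J" if "\<mu> \<in> ?K" for \<mu>
  proof -
    have "?c \<mu> = (\<Sum>\<nu>\<in>?K. (if \<nu> = \<mu> then 1 else 0) * ?c \<nu>)"
      using that by (simp add: if_distrib[of "\<lambda>x. x * _"] sum.delta cong: if_cong)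
    then show ?thesis using JI[of "\<lambda>\<nu>. if \<nu> = \<mu> then 1 else 0"] by simp
  qed
  obtain \<mu>0 where "\<mu>0 \<in> ?K" using poly_in_nonzero[OF nz, of j] by (metis keys_eq_empty equals0I)
  then have "\<exists>g. g \<in> J \<and> g \<noteq> 0" using Jc by (auto simp: in_keys_iff)
  then obtain g where g: "g \<in> J" "g \<noteq> 0" and min: "\<And>h. h \<in> J \<Longrightarrow> h \<noteq> 0 \<Longrightarrow> Polynomial.degree g \<le> Polynomial.degree h"
    using ex_has_least_nat[of "\<lambda>g. g \<in> J \<and> g \<noteq> 0" _ Polynomial.degree] by blast
  have dvd: "map_poly to_fract g dvd map_poly to_fract (?c \<mu>)" if "\<mu> \<in> ?K" for \<mu>
  proof -
    obtain e q r where eq: "e \<noteq> 0" "smult e (?c \<mu>) = g * q + r" "r = 0 \<or> Polynomial.degree r < Polynomial.degree g"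
      using pseudo_mod[OF g(2), of "?c \<mu>"] by auto
    have "r = [:e:] * ?c \<mu> + (- q) * g" using eq(2) by (simp add: algebra_simps)
    then have "r \<in> J" using J_lin[OF Jc[OF that] g(1), of "[:e:]" "- q"] by simp
    then have "r = 0" using eq(3) min[of r] by (metis not_less)
    then have "fract_poly (smult e (?c \<mu>)) = map_poly to_fract g * map_poly to_fract q"
      using eq(2) by (simp add: is_ring_homD[OF is_ring_hom_map_poly[OF is_ring_hom_to_fract]])
    then have "map_poly to_fract g dvd smult (to_fract e) (map_poly to_fract (?c \<mu>))"
      by simp
    then show ?thesis using eq(1) by (simp add: dvd_smult_iff)
  qed
  have "const_mpoly (map_poly to_fract g) dvd poly_in j (fract_mpoly G)"
    unfolding const_dvd_iff
  proof
    fix \<mu> show "map_poly to_fract g dvd Poly_Mapping.lookup (poly_in j (fract_mpoly G)) \<mu>"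
      using dvd[of \<mu>] by (cases "\<mu> \<in> ?K") (auto simp: lookup_poly_in_fract in_keys_iff)
  qed
  then have "Polynomial.degree (map_poly to_fract g) = 0" using no[of "map_poly to_fract g"] by (cases "Polynomial.degree (map_poly to_fract g) = 0") auto
  then have "Polynomial.degree g = 0" by (simp add: degree_map_poly)
  then obtain d where "g = [:d:]" by (auto elim: degree_eq_zeroE)
  then show thesis using g that[of d] by (auto simp: J_def)
qed

lemma prime_elem_dvd_prodD:
  "prime_elem p \<Longrightarrow> p dvd prod f A \<Longrightarrow> \<exists>x\<in>A. p dvd f x"
  by (induction A rule: infinite_finite_induct) (auto simp: prime_elem_dvd_mult_iff dest: prime_elem_not_unit)

text \<open>
  A common factor \<open>g(t)\<close> of least positive degree is irreducible, hence prime, so it divides one of the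
  irreducible factors. That factor would then be \<open>g(t)\<close> up to a constant, and involve no other variable.
\<close>

lemma no_common_factor_prod:
  fixes R :: "nat \<Rightarrow> 'k::field mpoly"
  assumes irr: "\<And>i. i < s \<Longrightarrow> Factorial_Ring.irreducible (R i)"
    and high: "\<And>i. i < s \<Longrightarrow> \<not> mpoly_vars (R i) \<subseteq> {..j}"
    and deg: "1 \<le> Polynomial.degree g"
  shows "\<not> const_mpoly g dvd poly_in j (\<Prod>i<s. R i)"
proof
  assume dvd: "const_mpoly g dvd poly_in j (\<Prod>i<s. R i)"
  obtain q where q: "1 \<le> Polynomial.degree q" "const_mpoly q dvd poly_in j (\<Prod>i<s. R i)"
    and min: "\<And>h. 1 \<le> Polynomial.degree h \<Longrightarrow> const_mpoly h dvd poly_in j (\<Prod>i<s. R i) \<Longrightarrow> Polynomial.degree q \<le> Polynomial.degree h"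
    using ex_has_least_nat[of "\<lambda>h. 1 \<le> Polynomial.degree h \<and> const_mpoly h dvd poly_in j (\<Prod>i<s. R i)" g Polynomial.degree] deg dvd by blast
  have unit0: "x dvd 1 \<longleftrightarrow> x \<noteq> 0 \<and> Polynomial.degree x = 0" for x :: "'k poly"
    by (cases "x = 0") (auto simp: is_unit_iff_degree)
  have "Factorial_Ring.irreducible q"
  proof (rule irreducibleI)
    show "q \<noteq> 0" "\<not> q dvd 1" using q by (auto simp: unit0)
    fix a b assume ab: "q = a * b"
    show "a dvd 1 \<or> b dvd 1"
    proof (rule ccontr)
      assume "\<not> ?thesis"
      moreover have "a \<noteq> 0" "b \<noteq> 0" using q ab by auto
      ultimately have pos: "1 \<le> Polynomial.degree a" "1 \<le> Polynomial.degree b" by (auto simp: unit0)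
      have "const_mpoly a dvd const_mpoly q" using is_ring_hom_dvd[OF is_ring_hom_const, of a q] ab by simp
      then have "Polynomial.degree q \<le> Polynomial.degree a" using min[OF pos(1)] q(2) dvd_trans by blast
      then show False using pos \<open>a \<noteq> 0\<close> \<open>b \<noteq> 0\<close> by (simp add: ab degree_mult_eq)
    qed
  qed
  then have "prime_elem (const_mpoly q)"
    by (intro prime_elem_const_mpoly field_poly_irreducible_imp_prime)
  moreover have "const_mpoly q dvd (\<Prod>i<s. poly_in j (R i))"
    using q(2) by (simp add: is_ring_hom_prod[OF is_ring_hom_poly_in])
  ultimately obtain i where i: "i < s" "const_mpoly q dvd poly_in j (R i)" using prime_elem_dvd_prodD by blast
  then obtain h where "poly_in j (R i) = const_mpoly q * h" by (auto elim: dvdE)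
  then have eq: "R i = poly_in_inv j (const_mpoly q) * poly_in_inv j h"
    by (metis poly_in_inv_poly_in is_ring_homD(4)[OF is_ring_hom_poly_in_inv])
  have nz: "R i \<noteq> 0" using irr[OF i(1)] by auto
  \<comment> \<open>Neither factor in \<open>eq\<close> is a unit: the first has positive degree in \<open>j\<close>, and if the second were one,
    \<open>R i\<close> would involve the variable \<open>j\<close> only.\<close>
  have "\<not> poly_in_inv j (const_mpoly q) dvd 1"
  proof
    assume "poly_in_inv j (const_mpoly q) dvd 1"
    from is_ring_hom_dvd[OF is_ring_hom_poly_in[of j] this] have "const_mpoly q dvd 1"
      by (simp add: poly_in_poly_in_inv_const is_ring_homD[OF is_ring_hom_poly_in])
    then have "q dvd 1" by (auto simp: const_dvd_iff dest: spec[of _ 0])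
    then show False using q(1) by (simp add: unit0)
  qed
  then have "poly_in_inv j h dvd 1" using irreducibleD[OF irr[OF i(1)] eq] by blast
  then obtain w where w: "1 = poly_in_inv j h * w" by (rule dvdE)
  then have "poly_in_inv j h \<noteq> 0" "w \<noteq> 0" by auto
  then have "mpoly_vars (poly_in_inv j h) = {}" using mpoly_vars_mult_idom[of "poly_in_inv j h" w] w by simp
  then have "mpoly_vars (R i) \<subseteq> {j}"
    using mpoly_vars_mult[of "poly_in_inv j (const_mpoly q)" "poly_in_inv j h"] mpoly_vars_poly_in_inv_const[of j q] eq by auto
  then show False using high[OF i(1)] by auto
qed

lemma content_contains_constant:
  fixes R :: "nat \<Rightarrow> 'a::idom mpoly"
  assumes irr: "\<And>i. i < s \<Longrightarrow> Factorial_Ring.irreducible (fract_mpoly (R i))"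
    and high: "\<And>i. i < s \<Longrightarrow> \<not> mpoly_vars (R i) \<subseteq> {..j}"
  defines "G \<equiv> \<Prod>i<s. R i"
  obtains d V where "d \<noteq> 0"
    "\<And>m. d = (\<Sum>\<mu>\<in>Poly_Mapping.keys (poly_in j G). poly (V \<mu>) m * Poly_Mapping.lookup (specialize_var j m G) \<mu>)"
proof -
  note hm = is_ring_hom_map[OF is_ring_hom_to_fract]
  have Gf: "fract_mpoly G = (\<Prod>i<s. fract_mpoly (R i))" by (simp add: G_def is_ring_hom_prod[OF hm])
  have "fract_mpoly (R i) \<noteq> 0" if "i < s" for i using irr[OF that] by auto
  then have "fract_mpoly G \<noteq> 0" unfolding Gf by (auto simp: prod_zero_iff)
  then have nz: "G \<noteq> 0" by (auto simp: is_ring_homD[OF hm])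
  have no: "\<not> const_mpoly g dvd poly_in j (fract_mpoly G)" if "1 \<le> Polynomial.degree g" for g
    unfolding Gf by (rule no_common_factor_prod) (use irr high that in auto)
  obtain d V where d: "d \<noteq> 0" "[:d:] = (\<Sum>\<mu>\<in>Poly_Mapping.keys (poly_in j G). V \<mu> * Poly_Mapping.lookup (poly_in j G) \<mu>)"
    using const_in_content_ideal[OF nz no] by blast
  show thesis
  proof
    show "d \<noteq> 0" by fact
    fix m
    have "d = poly [:d:] m" by simp
    also have "\<dots> = (\<Sum>\<mu>\<in>Poly_Mapping.keys (poly_in j G). poly (V \<mu>) m * Poly_Mapping.lookup (specialize_var j m G) \<mu>)"
      unfolding d(2) by (simp add: poly_sum lookup_specialize_var)
    finally show "d = (\<Sum>\<mu>\<in>Poly_Mapping.keys (poly_in j G). poly (V \<mu>) m * Poly_Mapping.lookup (specialize_var j m G) \<mu>)" .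
  qed
qed

section \<open>Values of polynomials outside finitely many primes\<close>

lemma prime_elem_power_dvdD: "prime_elem p \<Longrightarrow> p dvd x ^ n * y \<Longrightarrow> \<not> p dvd x \<Longrightarrow> p dvd y"
  by (induction n) (auto simp: prime_elem_dvd_mult_iff mult.assoc)

lemma dvd_diff_imp_dvd: "p dvd x - y \<Longrightarrow> p dvd x \<Longrightarrow> p dvd (y :: 'a::comm_ring_1)"
  using dvd_diff[of p x "x - y"] by simp

lemma poly_diff_dvd: "x - y dvd poly f x - poly f (y :: 'a::comm_ring_1)"
proof -
  have "poly f x = poly ([:- y, 1:] * synthetic_div f y + [:poly f y:]) x"
    by (simp only: synthetic_div_correct')
  then have "poly f x - poly f y = (x - y) * poly (synthetic_div f y) x"
    by (simp add: algebra_simps)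
  then show ?thesis by simp
qed

text \<open>
  Root counting in the domain of residues modulo \<open>p\<close>, without passing to the quotient.
\<close>

lemma prime_dvd_coeffs_of_many_roots:
  fixes f :: "'a::idom poly"
  assumes p: "prime_elem p" and fin: "finite A" and card: "Polynomial.degree f < card A"
    and inc: "\<And>x y. x \<in> A \<Longrightarrow> y \<in> A \<Longrightarrow> x \<noteq> y \<Longrightarrow> \<not> p dvd x - y"
    and root: "\<And>x. x \<in> A \<Longrightarrow> p dvd poly f x"
  shows "[:p:] dvd f"
  using assms(2-)
proof (induction "Polynomial.degree f" arbitrary: f A rule: less_induct)
  case less
  obtain a where a: "a \<in> A" using less.prems(1,2) by fastforce
  define g where "g = synthetic_div f a"
  have fg: "f = [:- a, 1:] * g + [:poly f a:]"
    using synthetic_div_correct'[of a f] by (simp add: g_def)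
  have pfa: "[:p:] dvd [:poly f a:]" using less.prems(4)[OF a] by (auto elim!: dvdE)
  show ?case
  proof (cases "Polynomial.degree f = 0")
    case True
    then show ?thesis using pfa by (auto elim!: degree_eq_zeroE)
  next
    case False
    have deg: "Polynomial.degree g = Polynomial.degree f - 1" by (simp add: g_def degree_synthetic_div)
    have "[:p:] dvd g"
    proof (rule less.hyps[of g "A - {a}"])
      show "Polynomial.degree g < Polynomial.degree f" using False deg by simp
      show "finite (A - {a})" using less.prems by simp
      show "Polynomial.degree g < card (A - {a})" using less.prems a deg False by simp
      fix x assume x: "x \<in> A - {a}"
      have "poly f x = (x - a) * poly g x + poly f a" by (subst fg) (simp add: algebra_simps)
      then have "p dvd (x - a) * poly g x" using less.prems(4)[of x] less.prems(4)[OF a] x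
        by (metis DiffD1 dvd_add_left_iff)
      then show "p dvd poly g x" using p less.prems(3)[of x a] a x by (auto simp: prime_elem_dvd_mult_iff)
    qed (use less.prems in auto)
    then show ?thesis using pfa by (subst fg) (intro dvd_add dvd_mult)
  qed
qed

text \<open>
  Suppose \<open>p\<close> divides all values on the progression, and let \<open>h(x) = f(z + (c - z) x)\<close>. Then \<open>p\<close> divides \<open>h(x)\<close> whenever \<open>a\<close> divides \<open>x\<close>, but not \<open>h(1)\<close>. If there are more residue classes
  modulo \<open>p\<close> than the degree of \<open>h\<close>, the multiples of \<open>a\<close> give too many roots. Otherwise two powers of \<open>a\<close>
  are congruent, so \<open>a\<close> is invertible modulo \<open>p\<close>, and \<open>1\<close> is congruent to a multiple of \<open>a\<close>.
\<close>

lemma prime_avoid_progression: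
  fixes f :: "'a::idom poly"
  assumes p: "prime_elem p" and a: "\<not> p dvd a" and c: "\<not> p dvd poly f c"
  obtains w where "\<not> p dvd poly f (z + a * w)"
proof (rule ccontr)
  assume "\<not> thesis"
  then have all: "p dvd poly f (z + a * w)" for w using that by blast
  define h where "h = pcompose f [:z, c - z:]"
  define n where "n = Suc (Polynomial.degree h)"
  have hx: "poly h x = poly f (z + (c - z) * x)" for x by (simp add: h_def poly_pcompose algebra_simps)
  have h1: "poly h 1 = poly f c" by (simp add: hx)
  have ha: "p dvd poly h (a * w)" for w using all[of "(c - z) * w"] by (simp add: hx algebra_simps)
  have cong: "p dvd poly h x - poly h y" if "p dvd x - y" for x y
  proof -
    have "x - y dvd poly h x - poly h y" by (rule poly_diff_dvd)
    then show ?thesis using that dvd_trans by blast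
  qed
  show False
  proof (cases "\<exists>A. finite A \<and> card A = n \<and> (\<forall>x\<in>A. \<forall>y\<in>A. x \<noteq> y \<longrightarrow> \<not> p dvd x - y)")
    case True
    then obtain A where A: "finite A" "card A = n" "\<forall>x\<in>A. \<forall>y\<in>A. x \<noteq> y \<longrightarrow> \<not> p dvd x - y" by blast
    have d: "\<not> p dvd x * a - y * a" if "x \<in> A" "y \<in> A" "x \<noteq> y" for x y
      using A(3) that a p by (auto simp: prime_elem_dvd_mult_iff simp flip: left_diff_distrib)
    have inj: "inj_on (\<lambda>x. x * a) A"
    proof (rule inj_onI, rule ccontr)
      fix x y assume "x \<in> A" "y \<in> A" "x * a = y * a" "x \<noteq> y"
      then show False using d[of x y] by simp
    qed
    have "[:p:] dvd h"
    proof (rule prime_dvd_coeffs_of_many_roots[OF p, of "(\<lambda>x. x * a) ` A"])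
      show "Polynomial.degree h < card ((\<lambda>x. x * a) ` A)" using A card_image[OF inj] by (simp add: n_def)
    qed (use A d ha in \<open>auto simp: mult.commute\<close>)
    then have "p dvd poly h 1" by (auto elim!: dvdE)
    then show False using c h1 by simp
  next
    case False
    have "\<exists>i j. i < j \<and> p dvd a ^ i - a ^ j"
    proof (rule ccontr)
      assume neg: "\<not> ?thesis"
      have *: "\<not> p dvd a ^ i - a ^ j" if "i \<noteq> j" for i j
proof (cases "i < j")
        case False
        then have "\<not> p dvd a ^ j - a ^ i" using neg that by (meson linorder_neqE_nat)
        then show ?thesis by (metis dvd_minus_iff minus_diff_eq)
      qed (use neg in blast)
      have inj: "inj_on (\<lambda>i. a ^ i) {..<n}" by (rule inj_onI) (metis * diff_self dvd_0_right)
      have "card ((\<lambda>i. a ^ i) ` {..<n}) = n" using card_image[OF inj] by simp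
      moreover have "\<forall>x\<in>(\<lambda>i. a ^ i) ` {..<n}. \<forall>y\<in>(\<lambda>i. a ^ i) ` {..<n}. x \<noteq> y \<longrightarrow> \<not> p dvd x - y"
      proof (intro ballI impI)
        fix x y assume "x \<in> (\<lambda>i. a ^ i) ` {..<n}" "y \<in> (\<lambda>i. a ^ i) ` {..<n}" "x \<noteq> y"
        then obtain i j where "x = a ^ i" "y = a ^ j" by blast
        then show "\<not> p dvd x - y" using *[of i j] \<open>x \<noteq> y\<close> by auto
      qed
      ultimately show False using False by (meson finite_imageI finite_lessThan)
    qed
    then obtain i j where ij: "i < j" "p dvd a ^ i - a ^ j" by blast
    have "a ^ i - a ^ j = a ^ i * (1 - a * a ^ (j - i - 1))"
    proof -
      have "j = i + Suc (j - i - 1)" using ij(1) by simp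
      then have "a ^ j = a ^ (i + Suc (j - i - 1))" by (rule arg_cong)
      then have "a ^ j = a ^ i * (a * a ^ (j - i - 1))" by (simp only: power_add power_Suc)
      then show ?thesis by (simp only: right_diff_distrib mult_1_right)
    qed
    with ij(2) have "p dvd a ^ i * (1 - a * a ^ (j - i - 1))" by (rule subst[rotated])
    then have "p dvd 1 - a * a ^ (j - i - 1)" by (rule prime_elem_power_dvdD[OF p _ a])
    then have "p dvd poly h 1 - poly h (a * a ^ (j - i - 1))" by (rule cong)
    then have "p dvd poly h 1" using ha[of "a ^ (j - i - 1)"] dvd_add diff_add_cancel by metis
    then show False using c h1 by simp
  qed
qed

text \<open>
  The next prime \<open>p\<close> is treated by moving within the class modulo the product of the previous ones. An
  associate of a previous prime imposes no further condition, and this is why all primes share one family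
  of polynomials.
\<close>

lemma avoid_finite_primes:
  fixes Fam :: "'a::idom poly set"
  assumes "finite T" "\<And>p. p \<in> T \<Longrightarrow> prime_elem p"
    and "\<And>p. p \<in> T \<Longrightarrow> \<exists>f\<in>Fam. \<exists>c. \<not> p dvd poly f c"
  obtains z where "\<And>p. p \<in> T \<Longrightarrow> \<exists>f\<in>Fam. \<not> p dvd poly f z"
proof -
  have "\<exists>z. \<forall>p\<in>T. \<exists>f\<in>Fam. \<not> p dvd poly f z"
    using assms
  proof (induction T rule: finite_induct)
    case (insert p T)
    then obtain z where z: "\<And>q. q \<in> T \<Longrightarrow> \<exists>f\<in>Fam. \<not> q dvd poly f z" by blast
    have p: "prime_elem p" using insert by simp
    show ?case
    proof (cases "\<exists>q\<in>T. p dvd q")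
      case True
      then obtain q where q: "q \<in> T" "p dvd q" by blast
      from q(2) obtain c where c: "q = p * c" by (rule dvdE)
      have q': "prime_elem q" using insert.prems(1)[of q] q(1) by simp
      have "q dvd p"
      proof (rule ccontr)
        assume "\<not> q dvd p"
        then have "q dvd c" using prime_elem_dvd_multD[OF q', of p c] c by auto
        then obtain e where "c = q * e" by (rule dvdE)
        then have "q * 1 = q * (p * e)" using c by (metis mult.left_commute mult_1_right)
        moreover have "q \<noteq> 0" using q' by (simp add: prime_elem_def)
        ultimately have "1 = p * e" by (metis mult_left_cancel)
        then show False using p by (metis dvd_triv_left prime_elem_def)
      qed
      then show ?thesis using z q(1) by (metis dvd_trans insertE)
    next
      case False
      define a where "a = \<Prod>T"
      have a: "\<not> p dvd a" unfolding a_def using prime_elem_dvd_prodD[OF p, of "\<lambda>x. x" T] False by auto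
      obtain f c where f: "f \<in> Fam" "\<not> p dvd poly f c" using insert.prems(2)[of p] by blast
      obtain w where w: "\<not> p dvd poly f (z + a * w)" using prime_avoid_progression[OF p a f(2)] by blast
      have "\<exists>g\<in>Fam. \<not> q dvd poly g (z + a * w)" if q: "q \<in> T" for q
      proof -
        obtain g where g: "g \<in> Fam" "\<not> q dvd poly g z" using z[OF q] by blast
        have "q dvd a" unfolding a_def using insert.hyps(1) q by (rule dvd_prodI)
        then have "q dvd (z + a * w) - z" by simp
        then have "q dvd poly g (z + a * w) - poly g z" using poly_diff_dvd dvd_trans by blast
        then have "\<not> q dvd poly g (z + a * w)" using g(2) dvd_diff_imp_dvd by blast
        then show ?thesis using g(1) by blast
      qed
      then show ?thesis using w f(1) by (intro exI[of _ "z + a * w"]) auto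
    qed
  qed auto
  then show thesis using that by blast
qed

section \<open>Specialization over a near UFD\<close>

lemma prime_elem_associated: "prime_elem p \<Longrightarrow> p dvd q \<Longrightarrow> q dvd p \<Longrightarrow> prime_elem q"
  unfolding prime_elem_def by (metis dvd_0_left dvd_trans)

lemma near_ufd_finite_primes:
  fixes E :: "'a::idom"
  assumes "near_ufd TYPE('a)" "E \<noteq> 0"
  obtains T where "finite T" "\<And>q. q \<in> T \<Longrightarrow> prime_elem q"
    "\<And>p. prime_elem p \<Longrightarrow> p dvd E \<Longrightarrow> \<exists>q\<in>T. p dvd q \<and> q dvd p"
proof -
  obtain S where S: "finite S" "\<And>p. prime_elem p \<Longrightarrow> p dvd E \<Longrightarrow> \<exists>q\<in>S. \<exists>u. u dvd 1 \<and> p = u * q"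
    using assms(1)[unfolded near_ufd_def, THEN conjunct1, rule_format, OF assms(2)] by auto
  show thesis
  proof
    show "finite {q\<in>S. prime_elem q}" using S(1) by simp
    fix p assume p: "prime_elem p" "p dvd E"
    then obtain q u where q: "q \<in> S" "u dvd 1" "p = u * q" using S(2) by blast
    then obtain v where "1 = u * v" by (auto elim: dvdE)
    then have "q = p * v" using q(3) by (simp add: mult.commute mult.left_commute)
    then have "p dvd q" by simp
    moreover have "q dvd p" using q(3) by simp
    ultimately show "\<exists>q\<in>{q\<in>S. prime_elem q}. p dvd q \<and> q dvd p"
      using q(1) prime_elem_associated[OF p(1)] by blast
  qed auto
qed

text \<open>
  The powers of a prime element are distinct. A prime element exists because \<open>0\<close> is a non-unit.
\<close>

lemma near_ufd_infinite:
  assumes "near_ufd TYPE('a::idom)"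
  shows "infinite (UNIV :: 'a set)"
proof
  assume fin: "finite (UNIV :: 'a set)"
  have "\<not> (0::'a) dvd 1" by simp
  then obtain p :: 'a where p: "prime_elem p" using assms unfolding near_ufd_def by blast
  have "p ^ i \<noteq> p ^ j" if "i < j" for i j
  proof
    assume "p ^ i = p ^ j"
    also have "j = i + Suc (j - i - 1)" using that by simp
    also have "p ^ (i + Suc (j - i - 1)) = p ^ i * (p * p ^ (j - i - 1))" by (simp only: power_add power_Suc)
    finally have "p ^ i * 1 = p ^ i * (p * p ^ (j - i - 1))" by simp
    then have "1 = p * p ^ (j - i - 1)" using p by (simp only: mult_cancel_left) (simp add: prime_elem_def)
    then show False using p by (metis dvd_triv_left prime_elem_def)
  qed
  then have "inj (\<lambda>i. p ^ i)" by (intro injI) (metis linorder_neqE_nat)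
  then show False using fin by (metis finite_UNIV_inj_surj finite_imageD finite_subset infinite_UNIV_nat subset_UNIV)
qed

text \<open>
  A bound for the degree in each variable. Specializing a variable preserves it, so that one \<open>D\<close> controls
  the univariate polynomials met when all variables are specialized in turn.
\<close>

definition exponents_le :: "'a::zero mpoly \<Rightarrow> nat \<Rightarrow> bool" where
  "exponents_le G D \<longleftrightarrow> (\<forall>\<mu>\<in>Poly_Mapping.keys G. \<forall>i. Poly_Mapping.lookup \<mu> i \<le> D)"

lemma exponents_le_exists: "\<exists>D. exponents_le G D"
proof -
  have "\<exists>D. \<forall>i. Poly_Mapping.lookup \<mu> i \<le> D" for \<mu> :: "nat \<Rightarrow>\<^sub>0 nat"
    by (rule exI[of _ "\<Sum>i\<in>Poly_Mapping.keys \<mu>. Poly_Mapping.lookup \<mu> i"])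
      (metis finite_keys in_keys_iff le0 member_le_sum)
  then obtain D where D: "\<And>\<mu> :: nat \<Rightarrow>\<^sub>0 nat. \<forall>i. Poly_Mapping.lookup \<mu> i \<le> D \<mu>" by metis
  have "exponents_le G (\<Sum>\<mu>\<in>Poly_Mapping.keys G. D \<mu>)"
    unfolding exponents_le_def
  proof (intro ballI allI)
    fix \<mu> i assume \<mu>: "\<mu> \<in> Poly_Mapping.keys G"
    have "Poly_Mapping.lookup \<mu> i \<le> D \<mu>" using D by blast
    also have "\<dots> \<le> (\<Sum>\<mu>\<in>Poly_Mapping.keys G. D \<mu>)" by (rule member_le_sum) (use \<mu> in auto)
    finally show "Poly_Mapping.lookup \<mu> i \<le> (\<Sum>\<mu>\<in>Poly_Mapping.keys G. D \<mu>)" .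
  qed
  then show ?thesis by blast
qed

lemma exponents_le_specialize_var: "exponents_le G D \<Longrightarrow> exponents_le (specialize_var j a G) D"
  unfolding exponents_le_def
proof (intro ballI allI)
  fix \<mu> i assume G: "\<forall>\<mu>\<in>Poly_Mapping.keys G. \<forall>i. Poly_Mapping.lookup \<mu> i \<le> D"
    and \<mu>: "\<mu> \<in> Poly_Mapping.keys (specialize_var j a G)"
  then have "Poly_Mapping.lookup (poly_in j G) \<mu> \<noteq> 0" by (auto simp: in_keys_iff lookup_specialize_var)
  then obtain d where "poly.coeff (Poly_Mapping.lookup (poly_in j G) \<mu>) d \<noteq> 0" by (auto simp: poly_eq_iff)
  then have "\<mu> + Poly_Mapping.single j d \<in> Poly_Mapping.keys G"
    by (auto simp: coeff_lookup_poly_in in_keys_iff split: if_splits)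
  then show "Poly_Mapping.lookup \<mu> i \<le> D" using G by (metis add_leD1 lookup_add)
qed

lemma degree_lookup_poly_in: "exponents_le G D \<Longrightarrow> Polynomial.degree (Poly_Mapping.lookup (poly_in j G) \<mu>) \<le> D"
proof (rule Polynomial.degree_le, intro allI impI, rule ccontr)
  fix d assume G: "exponents_le G D" and d: "D < d" "poly.coeff (Poly_Mapping.lookup (poly_in j G) \<mu>) d \<noteq> 0"
  then have "\<mu> + Poly_Mapping.single j d \<in> Poly_Mapping.keys G"
    by (auto simp: coeff_lookup_poly_in in_keys_iff split: if_splits)
  then have "Poly_Mapping.lookup (\<mu> + Poly_Mapping.single j d) j \<le> D" using G by (simp add: exponents_le_def)
  then show False using d(1) by (simp add: lookup_add)
qed

lemma specialize_id:
  assumes "mpoly_vars p \<subseteq> {k..}"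
  shows "specialize k m p = p"
proof -
  have "specialize k m p = mp_eval const_mpoly var_mpoly p"
    unfolding specialize_conv by (rule mp_eval_cong) (use assms in auto)
  then show ?thesis by (simp add: mp_eval_const_var)
qed

lemma mpoly_vars_specialize_var_interval: "mpoly_vars p \<subseteq> {j..<N} \<Longrightarrow> mpoly_vars (specialize_var j a p) \<subseteq> {Suc j..<N}"
  using mpoly_vars_specialize_var[of j a p] by fastforce

text \<open>
  One variable after the other: a coefficient in \<open>Z[t]\<close> that is nonzero modulo \<open>p\<close> has degree at most \<open>D\<close>, so
  it cannot vanish modulo \<open>p\<close> on the more than \<open>D\<close> distinct residue classes represented by \<open>B\<close>.
\<close>

lemma prime_nonvanishing:
  fixes G :: "'a::idom mpoly"
  assumes p: "prime_elem p" and B: "finite B" "D < card B"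
    and inc: "\<And>x y. x \<in> B \<Longrightarrow> y \<in> B \<Longrightarrow> x \<noteq> y \<Longrightarrow> \<not> p dvd x - y"
    and "j \<le> k" "mpoly_vars G \<subseteq> {j..<N}" "exponents_le G D" "\<not> const_mpoly p dvd G"
  shows "\<exists>m. \<not> const_mpoly p dvd specialize k m G"
  using assms(5-)
proof (induction j arbitrary: G rule: inc_induct)
  case base
  then have "mpoly_vars G \<subseteq> {k..}" by auto
  then show ?case using base specialize_id[of G k] by metis
next
  case (step j)
  obtain \<mu> where \<mu>: "\<not> p dvd Poly_Mapping.lookup G \<mu>" using step.prems by (auto simp: const_dvd_iff)
  define f where "f = Poly_Mapping.lookup (poly_in j G) (\<mu> - Poly_Mapping.single j (Poly_Mapping.lookup \<mu> j))"
  have "(\<mu> - Poly_Mapping.single j (Poly_Mapping.lookup \<mu> j)) + Poly_Mapping.single j (Poly_Mapping.lookup \<mu> j) = \<mu>"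
    by (rule poly_mapping_eqI) (auto simp: lookup_add Poly_Mapping.lookup_single when_def minus_poly_mapping.rep_eq)
  then have "poly.coeff f (Poly_Mapping.lookup \<mu> j) = Poly_Mapping.lookup G \<mu>"
    by (simp add: f_def coeff_lookup_poly_in minus_poly_mapping.rep_eq)
  then have "\<not> [:p:] dvd f" using \<mu> by (metis const_poly_dvd_iff)
  moreover have "Polynomial.degree f < card B" using degree_lookup_poly_in[OF step.prems(2)] B(2) unfolding f_def by (rule le_less_trans)
  ultimately obtain b where b: "\<not> p dvd poly f b"
    using prime_dvd_coeffs_of_many_roots[OF p B(1) _ inc, of f] by blast
  then have "\<not> const_mpoly p dvd specialize_var j b G" by (auto simp: const_dvd_iff lookup_specialize_var f_def)
  then obtain m where "\<not> const_mpoly p dvd specialize k m (specialize_var j b G)"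
    using step.IH[of "specialize_var j b G"] mpoly_vars_specialize_var_interval[of G j N b] exponents_le_specialize_var step.prems by blast
  then show ?case using specialize_specialize_var[OF step.hyps(2)] by metis
qed

lemma mpoly_no_vars:
  assumes "mpoly_vars F = {}"
  shows "F = const_mpoly (Poly_Mapping.lookup F 0)"
proof (rule poly_mapping_eqI)
  fix \<mu> show "Poly_Mapping.lookup F \<mu> = Poly_Mapping.lookup (const_mpoly (Poly_Mapping.lookup F 0)) \<mu>"
  proof (cases "\<mu> = 0")
    case False
    then have "Poly_Mapping.keys \<mu> \<noteq> {}" by simp
    then have "\<mu> \<notin> Poly_Mapping.keys F" using assms by (auto simp: mpoly_vars_def)
    then show ?thesis using False by (simp add: in_keys_iff const_mpoly_def Poly_Mapping.lookup_single)
  qed (simp add: const_mpoly_def)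
qed

lemma poly_in_keeps_variable:
  assumes "x \<in> mpoly_vars p" "x \<noteq> j"
  obtains \<mu> where "\<mu> \<in> Poly_Mapping.keys (poly_in j p)" "x \<in> Poly_Mapping.keys \<mu>"
proof -
  obtain \<mu> where \<mu>: "\<mu> \<in> Poly_Mapping.keys p" "x \<in> Poly_Mapping.keys \<mu>" using assms by (auto simp: mpoly_vars_def)
  define d where "d = Poly_Mapping.lookup \<mu> j"
  define \<nu> where "\<nu> = \<mu> - Poly_Mapping.single j d"
  have "\<nu> + Poly_Mapping.single j d = \<mu>" "Poly_Mapping.lookup \<nu> j = 0"
    by (auto intro!: poly_mapping_eqI simp: \<nu>_def d_def lookup_add Poly_Mapping.lookup_single when_def minus_poly_mapping.rep_eq)
  then have "poly.coeff (Poly_Mapping.lookup (poly_in j p) \<nu>) d \<noteq> 0" using \<mu> by (simp add: coeff_lookup_poly_in in_keys_iff)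
  then have "\<nu> \<in> Poly_Mapping.keys (poly_in j p)" by (auto simp: in_keys_iff)
  moreover have "x \<in> Poly_Mapping.keys \<nu>" using \<mu> assms
    by (simp add: in_keys_iff \<nu>_def minus_poly_mapping.rep_eq Poly_Mapping.lookup_single when_def)
  ultimately show thesis using that by blast
qed

lemma eval_mpoly_specialize_var: "eval_mpoly m (specialize_var j a p) = eval_mpoly (m(j := a)) p"
  unfolding specialize_var_def mp_eval_comp[OF is_ring_hom_eval_mpoly] unfolding eval_mpoly_conv
  by (rule mp_eval_cong) (auto simp: mp_eval_const[OF is_ring_hom_id] mp_eval_var[OF is_ring_hom_id])

text \<open>
  Leaves the variable \<open>j\<close> free, so that a coefficient of the full specialization becomes the value of a
  univariate polynomial at the \<open>j\<close>-th coordinate.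
\<close>

definition specialize_other_vars :: "nat \<Rightarrow> nat \<Rightarrow> (nat \<Rightarrow> 'a::comm_ring_1) \<Rightarrow> 'a mpoly \<Rightarrow> 'a mpoly" where
  "specialize_other_vars j k m = mp_eval const_mpoly (\<lambda>i. if i < k \<and> i \<noteq> j then const_mpoly (m i) else var_mpoly i)"

lemma poly_lookup_poly_in_specialize_other_vars:
  assumes "j < k"
  shows "poly (Poly_Mapping.lookup (poly_in j (specialize_other_vars j k m G)) \<nu>) a = Poly_Mapping.lookup (specialize k (m(j := a)) G) \<nu>"
proof -
  have "specialize_var j a (specialize_other_vars j k m G) = specialize k (m(j := a)) G"
    unfolding specialize_other_vars_def mp_eval_comp[OF is_ring_hom_specialize_var]
    unfolding specialize_conv specialize_var_def
    using assms by (intro mp_eval_cong) (auto simp: mp_eval_const[OF is_ring_hom_const] mp_eval_var[OF is_ring_hom_const])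
  then show ?thesis by (simp flip: lookup_specialize_var)
qed

lemma poly_fract_poly_to_fract: "poly (fract_poly f) (to_fract b) = to_fract (poly f b)"
  using hom_poly_map_poly[OF is_ring_hom_to_fract is_ring_hom_id, of f b] by (simp add: map_poly_idI)

text \<open>
  After specialization of the variable \<open>j\<close> in a suitable residue class, there is still no prime that
  divides all values. The critical primes are those dividing the constant \<open>d\<close> of
  \<open>content_contains_constant\<close>, and those with at most \<open>D\<close> residue classes, where \<open>D\<close> bounds the exponents.
\<close>

lemma near_ufd_specialization_step:
  fixes R :: "nat \<Rightarrow> 'z::idom mpoly"
  assumes nu: "near_ufd TYPE('z)" and jk: "j < k"
    and vars: "\<And>i. i < s \<Longrightarrow> mpoly_vars (R i) \<subseteq> {j..<N}"
    and irr: "\<And>i. i < s \<Longrightarrow> Factorial_Ring.irreducible (fract_mpoly (R i))"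
    and high: "\<And>i. i < s \<Longrightarrow> \<not> mpoly_vars (R i) \<subseteq> {..j}"
    and np: "\<And>p. prime_elem p \<Longrightarrow> \<exists>m. \<not> const_mpoly p dvd specialize k m (\<Prod>i<s. R i)"
  obtains a z where "a \<noteq> 0"
    "\<And>x p. a dvd x - z \<Longrightarrow> prime_elem p \<Longrightarrow> \<exists>m. \<not> const_mpoly p dvd specialize k m (specialize_var j x (\<Prod>i<s. R i))"
proof -
  define G where "G = (\<Prod>i<s. R i)"
  have Gvars: "mpoly_vars G \<subseteq> {j..<N}" unfolding G_def by (rule mpoly_vars_prod) (use vars in auto)
  obtain d V where d: "d \<noteq> 0" "\<And>m. d = (\<Sum>\<mu>\<in>Poly_Mapping.keys (poly_in j (\<Prod>i<s. R i)). poly (V \<mu>) m * Poly_Mapping.lookup (specialize_var j m (\<Prod>i<s. R i)) \<mu>)"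
    by (rule content_contains_constant[of s R j, OF irr high]) (assumption | rule that)+
  note d = d[folded G_def]
  obtain D where D: "exponents_le G D" using exponents_le_exists by blast
  obtain B :: "'z set" where B: "finite B" "card B = Suc D" using infinite_arbitrarily_large[OF near_ufd_infinite[OF nu]] by blast
  define P where "P = {(x, y). x \<in> B \<and> y \<in> B \<and> x \<noteq> y}"
  have finP: "finite P" by (rule finite_subset[of _ "B \<times> B"]) (use B in \<open>auto simp: P_def\<close>)
  \<comment> \<open>A prime with at most \<open>D\<close> residue classes identifies two elements of \<open>B\<close>, so it divides \<open>E\<close>.\<close>
  define E where "E = (\<Prod>(x, y)\<in>P. x - y) * d"
  have "E \<noteq> 0" using d(1) finP by (auto simp: E_def P_def)
  then obtain T where T: "finite T" "\<And>q. q \<in> T \<Longrightarrow> prime_elem q"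
    "\<And>p. prime_elem p \<Longrightarrow> p dvd E \<Longrightarrow> \<exists>q\<in>T. p dvd q \<and> q dvd p"
    using near_ufd_finite_primes[OF nu] by metis
  \<comment> \<open>The coefficients, as functions of the variable \<open>j\<close>, for all values of the other variables.\<close>
  define Fam where "Fam = {Poly_Mapping.lookup (poly_in j (specialize_other_vars j k m G)) \<nu> | m \<nu>. True}"
  have "\<exists>f\<in>Fam. \<exists>c. \<not> p dvd poly f c" if pT: "p \<in> T" for p
  proof -
    obtain m \<nu> where m: "\<not> p dvd Poly_Mapping.lookup (specialize k m G) \<nu>"
      using np[OF T(2)[OF pT]] by (auto simp: const_dvd_iff G_def)
    then have "\<not> p dvd poly (Poly_Mapping.lookup (poly_in j (specialize_other_vars j k m G)) \<nu>) (m j)"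
      by (simp add: poly_lookup_poly_in_specialize_other_vars[OF jk])
    then show ?thesis by (auto simp: Fam_def)
  qed
  then obtain z where z: "\<And>p. p \<in> T \<Longrightarrow> \<exists>f\<in>Fam. \<not> p dvd poly f z"
    using avoid_finite_primes[OF T(1,2), of Fam] by metis
  show thesis
  proof
    show "\<Prod>T \<noteq> 0" using T by (auto simp: prime_elem_def)
    fix x p :: 'z assume x: "\<Prod>T dvd x - z" and p: "prime_elem p"
    show "\<exists>m. \<not> const_mpoly p dvd specialize k m (specialize_var j x (\<Prod>i<s. R i))"
      unfolding G_def[symmetric]
    proof (cases "p dvd E")
      case True
      then obtain q where q: "q \<in> T" "p dvd q" "q dvd p" using T(3)[OF p] by blast
      obtain m \<nu> where f: "\<not> q dvd poly (Poly_Mapping.lookup (poly_in j (specialize_other_vars j k m G)) \<nu>) z" (is "\<not> q dvd poly ?f z")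
        using z[OF q(1)] by (auto simp: Fam_def)
      have "q dvd \<Prod>T" using T(1) q(1) by (rule dvd_prodI)
      also note x
      also have "x - z dvd poly ?f x - poly ?f z" by (rule poly_diff_dvd)
      finally have "q dvd poly ?f x - poly ?f z" .
      then have "\<not> q dvd poly ?f x" using f dvd_diff_imp_dvd[of q "poly ?f x"] by blast
      then have "\<not> p dvd poly ?f x" using q(3) dvd_trans by blast
      then have "\<not> p dvd Poly_Mapping.lookup (specialize k m (specialize_var j x G)) \<nu>"
        by (simp add: poly_lookup_poly_in_specialize_other_vars[OF jk] specialize_specialize_var[OF jk])
      then show "\<exists>m. \<not> const_mpoly p dvd specialize k m (specialize_var j x G)" by (auto simp: const_dvd_iff)
    next
      case False
      have "\<not> p dvd d" using False by (auto simp: E_def)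
      then have "\<not> const_mpoly p dvd specialize_var j x G"
      proof (rule contrapos_nn)
        assume "const_mpoly p dvd specialize_var j x G"
        then show "p dvd d"
          by (subst d(2)[of x]) (intro dvd_sum dvd_mult, simp add: const_dvd_iff)
      qed
      moreover have "\<not> p dvd u - v" if "u \<in> B" "v \<in> B" "u \<noteq> v" for u v
      proof
        assume "p dvd u - v"
        also have "u - v dvd (\<Prod>(x, y)\<in>P. x - y)"
          using dvd_prodI[OF finP, of "(u, v)" "\<lambda>(x, y). x - y"] that by (simp add: P_def)
        finally show False using False by (auto simp: E_def)
      qed
      ultimately show "\<exists>m. \<not> const_mpoly p dvd specialize k m (specialize_var j x G)"
        by (intro prime_nonvanishing[OF p B(1), of D "Suc j" k _ N])
          (use B jk mpoly_vars_specialize_var_interval[OF Gvars] exponents_le_specialize_var[OF D] in auto)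
    qed
  qed
qed

text \<open>
  Induction over the variables \<open>j, ..., k - 1\<close>. The polynomial \<open>F\<close> carries the Zariski density along.
\<close>

lemma near_ufd_specialization:
  fixes R :: "nat \<Rightarrow> 'z::idom mpoly" and F :: "'z fract mpoly"
  assumes hilb: "hilbertian_ring TYPE('z)" and nu: "near_ufd TYPE('z)"
    and s: "1 \<le> s" and kN: "k < N" and "j \<le> k"
    and "\<And>i. i < s \<Longrightarrow> mpoly_vars (R i) \<subseteq> {j..<N}"
    and "\<And>i. i < s \<Longrightarrow> Factorial_Ring.irreducible (fract_mpoly (R i))"
    and "\<And>i. i < s \<Longrightarrow> \<not> mpoly_vars (R i) \<subseteq> {..<k}"
    and "\<And>p. prime_elem p \<Longrightarrow> \<exists>m. \<not> const_mpoly p dvd specialize k m (\<Prod>i<s. R i)"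
    and "F \<noteq> 0" "mpoly_vars F \<subseteq> {j..<k}"
  shows "\<exists>m. (\<forall>i<s. Factorial_Ring.irreducible (fract_mpoly (specialize k m (R i)))) \<and>
     (\<forall>p. prime_elem p \<longrightarrow> \<not> const_mpoly p dvd specialize k m (\<Prod>i<s. R i)) \<and>
     eval_mpoly (\<lambda>i. to_fract (m i)) F \<noteq> 0"
  using assms(5-)
proof (induction j arbitrary: R F rule: inc_induct)
  case base
  have v: "mpoly_vars (R i) \<subseteq> {k..}" if "i < s" for i using base(1)[OF that] by auto
  have vG: "mpoly_vars (\<Prod>i<s. R i) \<subseteq> {k..}" by (rule mpoly_vars_prod) (use v in auto)
  have "mpoly_vars F = {}" using base(6) by simp
  then obtain c where F: "F = const_mpoly c" using mpoly_no_vars by blast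
  then have "eval_mpoly m F = c" for m
    unfolding eval_mpoly_conv by (simp add: mp_eval_const[OF is_ring_hom_id])
  moreover have "c \<noteq> 0" using base(5) F by auto
  ultimately show ?case
    using base(2,4) by (simp add: specialize_id[OF v] specialize_id[OF vG])
next
  case (step j)
  have high: "\<not> mpoly_vars (R i) \<subseteq> {..j}" if "i < s" for i
  proof
    assume "mpoly_vars (R i) \<subseteq> {..j}"
    then have "mpoly_vars (R i) \<subseteq> {..<k}" using step.hyps(2) by (meson atMost_iff lessThan_iff le_less_trans subset_iff)
    then show False using step.prems(3)[OF that] by simp
  qed
  obtain a z where a: "a \<noteq> 0" and
    az: "\<And>x p. a dvd x - z \<Longrightarrow> prime_elem p \<Longrightarrow> \<exists>m. \<not> const_mpoly p dvd specialize k m (specialize_var j x (\<Prod>i<s. R i))"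
    using near_ufd_specialization_step[OF nu step.hyps(2) step.prems(1,2) high step.prems(4)] by metis
  have "\<exists>\<mu> x. \<mu> \<in> Poly_Mapping.keys (poly_in j (R i)) \<and> x \<in> Poly_Mapping.keys \<mu> \<and> k \<le> x" if i: "i < s" for i
  proof -
    obtain x where x: "x \<in> mpoly_vars (R i)" "k \<le> x" using step.prems(3)[OF i] by (force simp: not_less)
    then have "x \<noteq> j" using step.hyps(2) by auto
    then show ?thesis using poly_in_keeps_variable[OF x(1)] x(2) by metis
  qed
  then obtain \<mu> x where \<mu>: "\<And>i. i < s \<Longrightarrow> \<mu> i \<in> Poly_Mapping.keys (poly_in j (R i)) \<and> x i \<in> Poly_Mapping.keys (\<mu> i) \<and> k \<le> x i"
    by metis
  obtain \<kappa> where \<kappa>: "\<kappa> \<in> Poly_Mapping.keys (poly_in j F)" using poly_in_nonzero[OF step.prems(5), of j] by (metis keys_eq_empty equals0I)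
  \<comment> \<open>Where \<open>f\<close> does not vanish, \<open>F\<close> stays nonzero and each \<open>R i\<close> keeps a monomial that involves one of
    the variables from \<open>k\<close> on.\<close>
  define f where "f = Poly_Mapping.lookup (poly_in j F) \<kappa> * (\<Prod>i<s. fract_poly (Poly_Mapping.lookup (poly_in j (R i)) (\<mu> i)))"
  have f: "f \<noteq> 0" using \<mu> \<kappa> by (auto simp: f_def in_keys_iff prod_zero_iff)
  have jN: "Suc j < N" using step.hyps kN by simp
  obtain b where b: "a dvd b - z" "poly f (to_fract b) \<noteq> 0"
    "\<And>i. i < s \<Longrightarrow> Factorial_Ring.irreducible (fract_mpoly (specialize_var j b (R i)))"
    by (rule hilbertian_progression[where R = R and z = z, OF hilb s jN _ _ _ f a])
      (assumption | rule step.prems(1,2) high that)+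
  define R' where "R' i = specialize_var j b (R i)" for i
  define F' where "F' = specialize_var j (to_fract b) F"
  have prod: "(\<Prod>i<s. R' i) = specialize_var j b (\<Prod>i<s. R i)"
    by (simp add: R'_def is_ring_hom_prod[OF is_ring_hom_specialize_var])
  have nz: "poly (Poly_Mapping.lookup (poly_in j F) \<kappa>) (to_fract b) \<noteq> 0"
    "i < s \<Longrightarrow> poly (Poly_Mapping.lookup (poly_in j (R i)) (\<mu> i)) b \<noteq> 0" for i
    using b(2) by (auto simp: f_def poly_prod prod_zero_iff poly_fract_poly_to_fract)
  have "\<exists>m. (\<forall>i<s. Factorial_Ring.irreducible (fract_mpoly (specialize k m (R' i)))) \<and>
     (\<forall>p. prime_elem p \<longrightarrow> \<not> const_mpoly p dvd specialize k m (\<Prod>i<s. R' i)) \<and>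
     eval_mpoly (\<lambda>i. to_fract (m i)) F' \<noteq> 0"
  proof (rule step.IH)
    show "mpoly_vars (R' i) \<subseteq> {Suc j..<N}" if "i < s" for i
      unfolding R'_def by (rule mpoly_vars_specialize_var_interval[OF step.prems(1)[OF that]])
    show "Factorial_Ring.irreducible (fract_mpoly (R' i))" if "i < s" for i
      unfolding R'_def by (rule b(3)[OF that])
    show "\<not> mpoly_vars (R' i) \<subseteq> {..<k}" if i: "i < s" for i
    proof -
      have "\<mu> i \<in> Poly_Mapping.keys (R' i)" using nz(2)[OF i] by (simp add: in_keys_iff R'_def lookup_specialize_var)
      then have "x i \<in> mpoly_vars (R' i)" using \<mu>[OF i] by (auto simp: mpoly_vars_def)
      then show ?thesis using \<mu>[OF i] by (auto dest!: subsetD)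
    qed
    show "\<exists>m. \<not> const_mpoly p dvd specialize k m (\<Prod>i<s. R' i)" if "prime_elem p" for p
      unfolding prod by (rule az[OF b(1) that])
    have "Poly_Mapping.lookup F' \<kappa> \<noteq> 0" using nz(1) by (simp add: F'_def lookup_specialize_var)
    then show "F' \<noteq> 0" by auto
    show "mpoly_vars F' \<subseteq> {Suc j..<k}" unfolding F'_def by (rule mpoly_vars_specialize_var_interval[OF step.prems(6)])
  qed
  then obtain m where m: "\<forall>i<s. Factorial_Ring.irreducible (fract_mpoly (specialize k m (R' i)))"
     "\<forall>p. prime_elem p \<longrightarrow> \<not> const_mpoly p dvd specialize k m (\<Prod>i<s. R' i)"
     "eval_mpoly (\<lambda>i. to_fract (m i)) F' \<noteq> 0" by blast
  have "(\<lambda>i. to_fract (m i))(j := to_fract b) = (\<lambda>i. to_fract ((m(j := b)) i))" by auto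
  then have "eval_mpoly (\<lambda>i. to_fract ((m(j := b)) i)) F \<noteq> 0"
    using m(3) unfolding F'_def eval_mpoly_specialize_var by simp
  moreover have "\<forall>i<s. Factorial_Ring.irreducible (fract_mpoly (specialize k (m(j := b)) (R i)))"
    using m(1) unfolding R'_def specialize_specialize_var[OF step.hyps(2)] .
  moreover have "\<forall>p. prime_elem p \<longrightarrow> \<not> const_mpoly p dvd specialize k (m(j := b)) (\<Prod>i<s. R i)"
    using m(2) unfolding prod specialize_specialize_var[OF step.hyps(2)] .
  ultimately show ?case by blast
qed

section \<open>Ideals of Dedekind domains\<close>

text \<open>
  Ideals as sets in a ring given by type classes; \<open>ideal_iff_ideal_set\<close> connects them with the record-based
  notion in the definition of Dedekind domains.
\<close>

definition ideal_set :: "'a::comm_ring_1 set \<Rightarrow> bool" where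
  "ideal_set I \<longleftrightarrow> 0 \<in> I \<and> (\<forall>x\<in>I. \<forall>y\<in>I. x + y \<in> I) \<and> (\<forall>x\<in>I. \<forall>r. r * x \<in> I)"

definition prime_ideal_set :: "'a::comm_ring_1 set \<Rightarrow> bool" where
  "prime_ideal_set P \<longleftrightarrow> ideal_set P \<and> 1 \<notin> P \<and> (\<forall>x y. x * y \<in> P \<longrightarrow> x \<in> P \<or> y \<in> P)"

lemma ideal_setD:
  assumes "ideal_set I"
  shows "0 \<in> I" "x \<in> I \<Longrightarrow> y \<in> I \<Longrightarrow> x + y \<in> I" "x \<in> I \<Longrightarrow> r * x \<in> I"
  using assms by (auto simp: ideal_set_def)

lemma ideal_set_dvd: "ideal_set I \<Longrightarrow> x \<in> I \<Longrightarrow> x dvd y \<Longrightarrow> y \<in> I"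
  by (auto simp: ideal_set_def mult.commute elim!: dvdE)

lemma ideal_set_diff: "ideal_set I \<Longrightarrow> x \<in> I \<Longrightarrow> y \<in> I \<Longrightarrow> x - y \<in> I"
  using ideal_setD(2)[of I x "- 1 * y"] ideal_setD(3)[of I y "- 1"] by simp

lemma ideal_set_sum: "ideal_set I \<Longrightarrow> (\<And>x. x \<in> A \<Longrightarrow> f x \<in> I) \<Longrightarrow> sum f A \<in> I"
  by (induction A rule: infinite_finite_induct) (auto simp: ideal_setD)

lemma ideal_iff_ideal_set: "ideal I (ring_of_type_algebra :: 'a::comm_ring_1 ring) \<longleftrightarrow> ideal_set I"
proof
  assume "ideal I (ring_of_type_algebra :: 'a ring)"
  then interpret ideal I "ring_of_type_algebra :: 'a ring" .
  show "ideal_set I"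
    using additive_subgroup.a_closed[OF additive_subgroup_axioms]
      additive_subgroup.zero_closed[OF additive_subgroup_axioms] I_l_closed
    by (auto simp: ideal_set_def ring_of_type_algebra_def)
next
  assume I: "ideal_set I"
  interpret ring "ring_of_type_algebra :: 'a ring" by (rule ring_from_type_algebra)
  have inv: "\<ominus>\<^bsub>(ring_of_type_algebra :: 'a ring)\<^esub> x = - x" for x :: 'a
    by (rule minus_equality) (auto simp: ring_of_type_algebra_def)
  show "ideal I (ring_of_type_algebra :: 'a ring)"
  proof (rule idealI)
    show "subgroup I (add_monoid (ring_of_type_algebra :: 'a ring))"
    proof (rule add.subgroupI)
      fix a assume "a \<in> I"
      then show "\<ominus>\<^bsub>(ring_of_type_algebra :: 'a ring)\<^esub> a \<in> I"
        unfolding inv using ideal_setD(3)[OF I, of a "- 1"] by simp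
    qed (use ideal_setD[OF I] in \<open>auto simp: ring_of_type_algebra_def\<close>)
  qed (use ideal_setD(3)[OF I] ring_axioms in \<open>auto simp: ring_of_type_algebra_def mult.commute\<close>)
qed

lemma ideal_set_adjoin:
  assumes "ideal_set P"
  shows "ideal_set {p + u * x | p x. p \<in> P}" (is "ideal_set ?J")
    and "P \<subseteq> {p + u * x | p x. p \<in> P}" and "u \<in> {p + u * x | p x. p \<in> P}"
proof -
  have J: "p + u * x \<in> ?J" if "p \<in> P" for p x using that by blast
  show "ideal_set ?J"
    unfolding ideal_set_def
  proof (intro conjI ballI allI)
    show "0 \<in> ?J" using J[OF ideal_setD(1)[OF assms], of 0] by simp
  next
    fix a b assume "a \<in> ?J" "b \<in> ?J"
    then obtain p x q y where "a = p + u * x" "b = q + u * y" "p \<in> P" "q \<in> P" by auto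
    then show "a + b \<in> ?J"
      using J[OF ideal_setD(2)[OF assms], of p q "x + y"] by (simp add: algebra_simps)
  next
    fix a r assume "a \<in> ?J"
    then obtain p x where "a = p + u * x" "p \<in> P" by auto
    then show "r * a \<in> ?J"
      using J[OF ideal_setD(3)[OF assms], of p r "r * x"] by (simp add: algebra_simps)
  qed
  show "P \<subseteq> ?J"
  proof
    fix x assume "x \<in> P"
    then show "x \<in> ?J" using J[of x 0] by simp
  qed
  show "u \<in> ?J" using J[OF ideal_setD(1)[OF assms], of 1] by simp
qed

lemma noetherian_maximal:
  fixes A :: "'a::idom set set"
  assumes "noetherian_domain (ring_of_type_algebra :: 'a ring)"
    and "A \<noteq> {}" "\<And>I. I \<in> A \<Longrightarrow> ideal_set I"
  obtains M where "M \<in> A" "\<And>I. I \<in> A \<Longrightarrow> M \<subseteq> I \<Longrightarrow> I = M"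
proof -
  interpret noetherian_domain "ring_of_type_algebra :: 'a ring" by fact
  have "\<exists>M\<in>A. \<forall>J\<in>A. M \<subseteq> J \<longrightarrow> J = M"
  proof (rule subset_Zorn_nonempty[OF assms(2)])
    fix C assume C: "C \<noteq> {}" "subset.chain A C"
    have "subset.chain {I. ideal I (ring_of_type_algebra :: 'a ring)} C"
      using C(2) assms(3) by (auto simp: subset_chain_def ideal_iff_ideal_set)
    then have "\<Union>C \<in> C" using ideal_chain_is_trivial C(1) by blast
    then show "\<Union>C \<in> A" using C(2) by (auto simp: subset_chain_def)
  qed
  then show thesis using that by blast
qed

lemma prime_ideal_above:
  fixes I :: "'a::idom set"
  assumes noeth: "noetherian_domain (ring_of_type_algebra :: 'a ring)"
    and I: "ideal_set I" and S: "1 \<in> S" "\<And>x y. x \<in> S \<Longrightarrow> y \<in> S \<Longrightarrow> x * y \<in> S" "I \<inter> S = {}"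
  obtains P where "prime_ideal_set P" "I \<subseteq> P" "P \<inter> S = {}"
proof -
  obtain P where P: "P \<in> {J. ideal_set J \<and> I \<subseteq> J \<and> J \<inter> S = {}}"
    and max: "\<And>J. J \<in> {J. ideal_set J \<and> I \<subseteq> J \<and> J \<inter> S = {}} \<Longrightarrow> P \<subseteq> J \<Longrightarrow> J = P"
    by (rule noetherian_maximal[OF noeth, of "{J. ideal_set J \<and> I \<subseteq> J \<and> J \<inter> S = {}}"]) (use I S in auto)
  have id: "ideal_set P" "I \<subseteq> P" "P \<inter> S = {}" using P by auto
  have meet: "\<exists>p x. p \<in> P \<and> p + a * x \<in> S" if a: "a \<notin> P" for a
  proof (rule ccontr)
    assume neg: "\<not> ?thesis"
    let ?J = "{p + a * x | p x. p \<in> P}"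
    note J = ideal_set_adjoin[OF id(1), of a]
    have "?J \<inter> S = {}" using neg by auto
    moreover have "I \<subseteq> ?J" using id(2) J(2) by (rule subset_trans)
    ultimately have "?J = P" using J(1,2) by (intro max) simp_all
    moreover have "a \<in> ?J" by (rule J(3))
    ultimately show False using a by simp
  qed
  have "a \<in> P \<or> b \<in> P" if ab: "a * b \<in> P" for a b
  proof (rule ccontr)
    assume "\<not> ?thesis"
    then obtain p x q y where pq: "p \<in> P" "p + a * x \<in> S" "q \<in> P" "q + b * y \<in> S" using meet by blast
    have "(p + a * x) * (q + b * y) = (q + b * y) * p + ((a * x) * q + (x * y) * (a * b))" by (simp add: algebra_simps)
    also have "\<dots> \<in> P"
      by (rule ideal_setD(2)[OF id(1) ideal_setD(3)[OF id(1) pq(1)]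
            ideal_setD(2)[OF id(1) ideal_setD(3)[OF id(1) pq(3)] ideal_setD(3)[OF id(1) ab]]])
    finally show False using S(2)[OF pq(2,4)] id(3) by auto
  qed
  then have "prime_ideal_set P" using id S(1) by (auto simp: prime_ideal_set_def)
  then show thesis using id that by blast
qed

lemma dedekind_inverse_mod:
  fixes P :: "'a::idom set"
  assumes D: "dedekind_domain TYPE('a)" and P: "prime_ideal_set P"
    and x0: "x0 \<in> P" "x0 \<noteq> 0" and u: "u \<notin> P"
  obtains x where "1 - u * x \<in> P"
proof -
  have id: "ideal_set P" using P by (simp add: prime_ideal_set_def)
  have "primeideal P (ring_of_type_algebra :: 'a ring)"
  proof (rule primeidealI)
    show "cring (ring_of_type_algebra :: 'a ring)" by (rule cring_from_type_algebra)
    show "ideal P (ring_of_type_algebra :: 'a ring)" using id by (simp add: ideal_iff_ideal_set)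
  qed (use P in \<open>auto simp: prime_ideal_set_def ring_of_type_algebra_def\<close>)
  then have "maximalideal P (ring_of_type_algebra :: 'a ring)"
    using D x0 by (auto simp: dedekind_domain_def)
  then interpret maximalideal P "ring_of_type_algebra :: 'a ring" .
  let ?J = "{p + u * x | p x. p \<in> P}"
  have "ideal ?J (ring_of_type_algebra :: 'a ring)" using ideal_set_adjoin[OF id] by (simp add: ideal_iff_ideal_set)
  moreover have "P \<subseteq> ?J" "u \<in> ?J" using ideal_set_adjoin[OF id] by auto
  ultimately have "?J = UNIV" using I_maximal[of ?J] u by (auto simp: ring_of_type_algebra_def)
  then have "1 \<in> ?J" by simp
  then obtain p x where px: "p \<in> P" "1 = p + u * x" by blast
  then have "1 - u * x = p" by (simp only: px(2)) simp
  with px(1) have "1 - u * x \<in> P" by simp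
  then show thesis using that by blast
qed

lemma prime_ideal_set_power: "prime_ideal_set P \<Longrightarrow> x ^ n \<in> P \<Longrightarrow> x \<in> P"
  by (induction n) (auto simp: prime_ideal_set_def)

text \<open>
  Modulo \<open>d\<close> all primes are maximal, so the descending powers of \<open>u\<close> become stationary: otherwise a prime
  containing \<open>d\<close> would avoid all \<open>u ^ n * (1 - u * x)\<close>, but \<open>u\<close> is invertible modulo that prime. From
  \<open>u ^ n = u ^ (n + 1) * x\<close> modulo \<open>d\<close> it follows that \<open>(u * x) ^ n\<close> is idempotent modulo \<open>d\<close>.
\<close>

lemma idempotent_mod:
  fixes P :: "'a::idom set"
  assumes D: "dedekind_domain TYPE('a)" and P: "prime_ideal_set P"
    and d: "d \<in> P" "d \<noteq> 0" and u: "u \<notin> P"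
  obtains g where "u dvd g" "d dvd g * (1 - g)" "g \<notin> P"
proof -
  have noeth: "noetherian_domain (ring_of_type_algebra :: 'a ring)" using D by (simp add: dedekind_domain_def)
  have id: "ideal_set P" and P1: "1 \<notin> P" and Pp: "\<And>x y. x * y \<in> P \<Longrightarrow> x \<in> P \<or> y \<in> P" using P by (auto simp: prime_ideal_set_def)
  define S where "S = {u ^ n * (1 - u * x) | n x. True}"
  have S1: "1 \<in> S" by (auto simp: S_def intro!: exI[of _ 0])
  have Sm: "x * y \<in> S" if xy: "x \<in> S" "y \<in> S" for x y
  proof -
    obtain n m a b where *: "x = u ^ n * (1 - u * a)" "y = u ^ m * (1 - u * b)" using xy by (auto simp: S_def)
    have "x * y = u ^ (n + m) * (1 - u * (a + b - u * a * b))" unfolding * by (simp add: power_add algebra_simps)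
    then show ?thesis by (auto simp: S_def)
  qed
  have "\<exists>n x. d dvd u ^ n * (1 - u * x)"
  proof (rule ccontr)
    assume neg: "\<not> ?thesis"
    have "ideal_set {x. d dvd x}" by (auto simp: ideal_set_def)
    moreover have "{x. d dvd x} \<inter> S = {}" using neg by (auto simp: S_def)
    ultimately obtain P' where P': "prime_ideal_set P'" "{x. d dvd x} \<subseteq> P'" "P' \<inter> S = {}"
      using prime_ideal_above[OF noeth _ S1 Sm] by metis
    have "u ^ 1 * (1 - u * 0) \<in> S" unfolding S_def by blast
    then have "u \<notin> P'" using P'(3) by auto
    moreover have "d \<in> P'" using P'(2) by auto
    ultimately obtain x where "1 - u * x \<in> P'" using dedekind_inverse_mod[OF D P'(1) _ d(2)] by metis
    moreover have "u ^ 0 * (1 - u * x) \<in> S" unfolding S_def by blast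
    ultimately show False using P'(3) by auto
  qed
  then obtain n x where nx: "d dvd u ^ n * (1 - u * x)" by blast
  \<comment> \<open>The exponent \<open>Suc n\<close> makes \<open>u\<close> a divisor of \<open>g\<close> also when \<open>n = 0\<close>.\<close>
  define g where "g = (u * x) ^ Suc n"
  show thesis
  proof
    show "u dvd g" by (simp add: g_def)
    have "1 - u * x dvd 1 - g"
      unfolding g_def using one_diff_power_eq'[of "u * x" "Suc n"] by (metis dvd_triv_left)
    moreover have "u ^ n dvd g" by (simp add: g_def power_mult_distrib)
    ultimately show "d dvd g * (1 - g)" using nx mult_dvd_mono dvd_trans by blast
    show "g \<notin> P"
    proof
      assume "g \<in> P"
      then have ux: "u * x \<in> P" unfolding g_def by (rule prime_ideal_set_power[OF P])
      have "u ^ n * (1 - u * x) \<in> P" using ideal_set_dvd[OF id d(1) nx] .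
      then have "1 - u * x \<in> P" using Pp prime_ideal_set_power[OF P] u by blast
      then have "(1 - u * x) + u * x \<in> P" using ux ideal_setD(2)[OF id] by blast
      then show False using P1 by simp
    qed
  qed
qed

text \<open>
  The prime \<open>P\<close> is associated to \<open>(a)\<close>: a maximal member among the ideals \<open>(a) : b\<close> contained in \<open>P\<close> is
  prime, and being nonzero it is maximal, so it is \<open>P\<close>.
\<close>

lemma prime_is_colon:
  fixes P :: "'a::idom set"
  assumes D: "dedekind_domain TYPE('a)" and P: "prime_ideal_set P"
    and a: "a \<in> P" "a \<noteq> 0"
  obtains b where "\<And>x. x \<in> P \<longleftrightarrow> a dvd b * x"
proof -
  have noeth: "noetherian_domain (ring_of_type_algebra :: 'a ring)" using D by (simp add: dedekind_domain_def)
  have id: "ideal_set P" and P1: "1 \<notin> P" and Pp: "\<And>x y. x * y \<in> P \<Longrightarrow> x \<in> P \<or> y \<in> P" using P by (auto simp: prime_ideal_set_def)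
  define Q where "Q b = {x. a dvd b * x}" for b
  have Q_ideal: "ideal_set (Q b)" for b
    by (auto simp: ideal_set_def Q_def distrib_left mult.left_commute)
  define F where "F = {Q b | b. Q b \<subseteq> P}"
  have "Q 1 \<subseteq> P" using ideal_set_dvd[OF id a(1)] by (auto simp: Q_def)
  then have "F \<noteq> {}" by (auto simp: F_def)
  moreover have "ideal_set I" if "I \<in> F" for I using that Q_ideal by (auto simp: F_def)
  ultimately obtain M where M: "M \<in> F" "\<And>I. I \<in> F \<Longrightarrow> M \<subseteq> I \<Longrightarrow> I = M"
    by (rule noetherian_maximal[OF noeth]) (assumption | rule that)+
  then obtain b where b: "Q b \<subseteq> P" "M = Q b" unfolding F_def by blast
  have max: "Q c = Q b" if "Q c \<subseteq> P" "Q b \<subseteq> Q c" for c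
    using M(2)[of "Q c"] that b(2) by (auto simp: F_def)
  note b = b(1)
  have "x \<in> Q b \<or> y \<in> Q b" if xy: "x * y \<in> Q b" for x y
  proof (cases "Q (b * x) \<subseteq> P")
    case True
    then have "Q (b * x) = Q b" by (rule max) (auto simp: Q_def mult.assoc mult.left_commute[of b x])
    moreover have "y \<in> Q (b * x)" using xy by (simp add: Q_def mult.assoc)
    ultimately show ?thesis by simp
  next
    case False
    then obtain v where v: "v \<notin> P" "a dvd b * x * v" by (auto simp: Q_def)
    have "Q (b * v) \<subseteq> P"
    proof
      fix w assume "w \<in> Q (b * v)"
      then have "v * w \<in> Q b" by (simp add: Q_def mult.assoc)
      then show "w \<in> P" using b Pp v(1) by blast
    qed
    then have "Q (b * v) = Q b" by (rule max) (auto simp: Q_def mult.assoc mult.left_commute[of b v])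
    moreover have "x \<in> Q (b * v)" using v(2) by (simp add: Q_def ac_simps)
    ultimately show ?thesis by simp
  qed
  then have Qp: "prime_ideal_set (Q b)" using Q_ideal b P1 by (auto simp: prime_ideal_set_def)
  have aQ: "a \<in> Q b" by (simp add: Q_def)
  have "P \<subseteq> Q b"
  proof (rule subsetI, rule ccontr)
    fix x assume x: "x \<in> P" "x \<notin> Q b"
    obtain y where "1 - x * y \<in> Q b" using dedekind_inverse_mod[OF D Qp aQ a(2) x(2)] .
    then have "(1 - x * y) + y * x \<in> P" using b x(1) by (intro ideal_setD[OF id]) auto
    then show False using P1 by (simp add: mult.commute)
  qed
  then show thesis using b that[of b] by (auto simp: Q_def)
qed

lemma integral_power_relation:
  assumes ic: "integrally_closed TYPE('a::idom)" and eq: "x ^ Suc N = (\<Sum>i\<le>N. to_fract (c i) * x ^ i)"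
  shows "x \<in> range (to_fract :: 'a \<Rightarrow> 'a fract)"
proof -
  define g where "g = (\<Sum>i\<le>N. Polynomial.monom (c i) i)"
  define f where "f = Polynomial.monom 1 (Suc N) - g"
  have cg: "poly.coeff g n = (if n \<le> N then c n else 0)" for n
    by (simp add: g_def coeff_sum)
  have "Polynomial.degree f = Suc N"
  proof (rule antisym)
    show "Polynomial.degree f \<le> Suc N" by (rule Polynomial.degree_le) (simp add: f_def cg)
    show "Suc N \<le> Polynomial.degree f" by (rule le_degree) (simp add: f_def cg)
  qed
  then have lc: "Polynomial.lead_coeff f = 1" by (simp add: f_def cg)
  note hm = is_ring_hom_map_poly[OF is_ring_hom_to_fract]
  have fm: "fract_poly (Polynomial.monom a n) = Polynomial.monom (to_fract a) n" for a :: 'a and n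
    by (rule poly_eqI) (simp add: coeff_map_poly)
  have "fract_poly f + fract_poly g = fract_poly (f + g)" by (simp add: is_ring_homD[OF hm])
  also have "\<dots> = Polynomial.monom 1 (Suc N)" by (simp add: f_def fm)
  finally have "poly (fract_poly f + fract_poly g) x = poly (Polynomial.monom 1 (Suc N)) x" by (rule arg_cong)
  moreover have "poly (fract_poly g) x = x ^ Suc N"
    unfolding g_def is_ring_hom_sum[OF hm] eq by (simp add: fm poly_sum poly_monom)
  ultimately have "poly (fract_poly f) x = 0" by (simp add: poly_monom)
  then show ?thesis using ic lc unfolding integrally_closed_def by blast
qed

text \<open>
  With \<open>P = (a) : b\<close>, the fraction \<open>x = b / a\<close> multiplies \<open>P\<close> into the ring. If the image is not contained in
  \<open>P\<close>, an element \<open>p\<close> with \<open>x p = u\<close> outside \<open>P\<close> generates \<open>P\<close> locally. If it is, all \<open>a x ^ n\<close> lie in the ring,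
  the chain of ideals generated by \<open>a, a x, ..., a x ^ n\<close> becomes stationary, and this is an integral
  equation for \<open>x\<close>; so \<open>x\<close> is in the ring, which says that \<open>1\<close> is in \<open>(a) : b = P\<close>.
\<close>

lemma local_uniformizer:
  fixes P :: "'a::idom set"
  assumes D: "dedekind_domain TYPE('a)" and P: "prime_ideal_set P"
    and a: "a \<in> P" "a \<noteq> 0"
  obtains p u where "p \<in> P" "u \<notin> P" "\<And>q. q \<in> P \<Longrightarrow> p dvd u * q"
proof -
  have noeth: "noetherian_domain (ring_of_type_algebra :: 'a ring)"
    and ic: "integrally_closed TYPE('a)" using D by (auto simp: dedekind_domain_def)
  have P1: "1 \<notin> P" using P by (auto simp: prime_ideal_set_def)
  obtain b where b: "\<And>x. x \<in> P \<longleftrightarrow> a dvd b * x" using prime_is_colon[OF D P a] by blast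
  show thesis
  proof (cases "\<exists>p u. p \<in> P \<and> u \<notin> P \<and> b * p = a * u")
    case True
    then obtain p u where pu: "p \<in> P" "u \<notin> P" "b * p = a * u" by blast
    have "p dvd u * q" if q: "q \<in> P" for q
    proof -
      obtain r where r: "b * q = a * r" using b q by (auto elim: dvdE)
      have "a * (u * q) = b * p * q" by (simp add: pu(3) mult.assoc)
      also have "\<dots> = p * (b * q)" by (simp add: ac_simps)
      also have "\<dots> = a * (p * r)" by (simp add: r ac_simps)
      finally have "u * q = p * r" using a(2) by simp
      then show ?thesis by simp
    qed
    then show thesis using pu that by blast
  next
    case False
    have "\<exists>q. q \<in> P \<and> b * p = a * q" if "p \<in> P" for p
      using b[of p] that False by (auto elim!: dvdE)
    then obtain h where h: "\<And>p. p \<in> P \<Longrightarrow> h p \<in> P" "\<And>p. p \<in> P \<Longrightarrow> b * p = a * h p" by metis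
    \<comment> \<open>\<open>h\<close> is multiplication by \<open>b / a\<close> on \<open>P\<close>, so \<open>e n\<close> is \<open>a * (b / a) ^ n\<close>.\<close>
    define e where "e n = (h ^^ n) a" for n
    have eP: "e n \<in> P" for n by (induction n) (auto simp: e_def a h)
    define x where "x = to_fract b / to_fract a"
    have ex: "to_fract (e n) = to_fract a * x ^ n" for n
    proof (induction n)
      case (Suc n)
      have "to_fract a * to_fract (e (Suc n)) = to_fract b * to_fract (e n)"
        using h(2)[OF eP, of n] by (simp add: e_def flip: to_fract_mult)
      then have "to_fract (e (Suc n)) = x * to_fract (e n)" using a(2) by (simp add: x_def field_simps)
      then show ?case by (simp add: Suc)
    qed (simp add: e_def)
    define I where "I n = range (\<lambda>c. \<Sum>i\<le>n. c i * e i)" for n :: nat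
    have "ideal_set (I n)" for n
      unfolding ideal_set_def
    proof (intro conjI ballI allI)
      show "0 \<in> I n" by (auto simp: I_def intro!: range_eqI[of _ _ "\<lambda>_. 0"])
      fix y z assume "y \<in> I n" "z \<in> I n"
      then obtain c d where "y = (\<Sum>i\<le>n. c i * e i)" "z = (\<Sum>i\<le>n. d i * e i)" by (auto simp: I_def)
      then show "y + z \<in> I n" by (auto simp: I_def sum.distrib algebra_simps intro!: range_eqI[of _ _ "\<lambda>i. c i + d i"])
    next
      fix y r assume "y \<in> I n"
      then obtain c where "y = (\<Sum>i\<le>n. c i * e i)" by (auto simp: I_def)
      then show "r * y \<in> I n" by (auto simp: I_def sum_distrib_left mult.assoc intro!: range_eqI[of _ _ "\<lambda>i. r * c i"])
    qed
    then have "ideal_set J" if "J \<in> range I" for J using that by auto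
    then obtain M where M: "M \<in> range I" "\<And>J. J \<in> range I \<Longrightarrow> M \<subseteq> J \<Longrightarrow> J = M"
      by (rule noetherian_maximal[OF noeth, rotated]) auto
    then obtain N where N: "M = I N" by blast
    have "I N \<subseteq> I (Suc N)"
    proof
      fix y assume "y \<in> I N"
      then obtain c where "y = (\<Sum>i\<le>N. c i * e i)" by (auto simp: I_def)
      then show "y \<in> I (Suc N)" by (auto simp: I_def intro!: range_eqI[of _ _ "c(Suc N := 0)"])
    qed
    then have "I (Suc N) = I N" using M N by blast
    moreover have "e (Suc N) \<in> I (Suc N)"
      by (auto simp: I_def intro!: range_eqI[of _ _ "\<lambda>i. if i = Suc N then 1 else 0"])
    ultimately obtain c where c: "e (Suc N) = (\<Sum>i\<le>N. c i * e i)" by (auto simp: I_def)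
    have "to_fract a * x ^ Suc N = to_fract a * (\<Sum>i\<le>N. to_fract (c i) * x ^ i)"
      using arg_cong[OF c, of to_fract] unfolding ex
      by (simp only: to_fract_sum to_fract_mult ex sum_distrib_left mult.left_commute[of _ "to_fract a"])
    then have "x ^ Suc N = (\<Sum>i\<le>N. to_fract (c i) * x ^ i)" using a(2) by simp
    then obtain y where "x = to_fract y" using integral_power_relation[OF ic] by blast
    then have "to_fract b = to_fract (a * y)" using a(2) by (simp add: x_def field_simps)
    then have "a dvd b * 1" by (simp only: to_fract_eq_iff) simp
    then show thesis using b P1 by blast
  qed
qed

text \<open>
  Up to elements outside \<open>P\<close>, every nonzero \<open>c\<close> is a power of the uniformizer. Dividing an exception by \<open>p\<close>
  would give another exception that generates a strictly larger ideal \<open>L\<close> in the localization at \<open>P\<close>,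
  and such a chain stops.
\<close>

lemma local_valuation:
  fixes P :: "'a::idom set"
  assumes noeth: "noetherian_domain (ring_of_type_algebra :: 'a ring)" and P: "prime_ideal_set P"
    and p: "p \<in> P" and u: "u \<notin> P" and unif: "\<And>q. q \<in> P \<Longrightarrow> p dvd u * q" and c: "c \<noteq> 0"
  shows "\<exists>n v w. v \<notin> P \<and> w \<notin> P \<and> v * c = w * (p :: 'a) ^ n"
proof (rule ccontr)
  assume bad: "\<not> ?thesis"
  have id: "ideal_set P" and P1: "1 \<notin> P" and Pp: "\<And>x y. x * y \<in> P \<Longrightarrow> x \<in> P \<or> y \<in> P" using P by (auto simp: prime_ideal_set_def)
  define good where "good c \<longleftrightarrow> (\<exists>n v w. v \<notin> P \<and> w \<notin> P \<and> v * c = w * p ^ n)" for c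
  define L where "L c = {x. \<exists>v. v \<notin> P \<and> c dvd v * x}" for c
  have L_ideal: "ideal_set (L c)" for c
    unfolding ideal_set_def
  proof (intro conjI ballI allI)
    show "0 \<in> L c" using P1 by (auto simp: L_def)
    fix x y assume "x \<in> L c" "y \<in> L c"
    then obtain v w where vw: "v \<notin> P" "c dvd v * x" "w \<notin> P" "c dvd w * y" by (auto simp: L_def)
    have "c dvd w * (v * x) + v * (w * y)" by (rule dvd_add[OF dvd_mult[OF vw(2)] dvd_mult[OF vw(4)]])
    then have "c dvd (v * w) * (x + y)" by (simp add: algebra_simps)
    moreover have "v * w \<notin> P" using Pp vw by blast
    ultimately show "x + y \<in> L c" by (auto simp: L_def)
  next
    fix x r assume "x \<in> L c"
    then obtain v where "v \<notin> P" "c dvd v * x" by (auto simp: L_def)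
    moreover from this have "c dvd v * (r * x)" by (metis dvd_mult mult.left_commute)
    ultimately show "r * x \<in> L c" by (auto simp: L_def)
  qed
  define F where "F = {L c | c. c \<noteq> 0 \<and> \<not> good c}"
  have "F \<noteq> {}" using bad c by (auto simp: F_def good_def)
  moreover have "ideal_set I" if "I \<in> F" for I using that L_ideal by (auto simp: F_def)
  ultimately obtain M where M: "M \<in> F" "\<And>I. I \<in> F \<Longrightarrow> M \<subseteq> I \<Longrightarrow> I = M"
    by (rule noetherian_maximal[OF noeth]) (assumption | rule that)+
  then obtain c where c: "c \<noteq> 0" "\<not> good c" "M = L c" unfolding F_def by blast
  have max: "L r = L c" if "r \<noteq> 0" "\<not> good r" "L c \<subseteq> L r" for r
    using M(2)[of "L r"] that c(3) by (auto simp: F_def)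
  have "c \<in> P"
  proof (rule ccontr)
    assume "c \<notin> P"
    then have "good c" unfolding good_def by (intro exI[of _ 0] exI[of _ 1] exI[of _ c]) (use P1 in auto)
    then show False using c by simp
  qed
  then obtain r where r: "u * c = p * r" using unif by (auto elim: dvdE)
  have "u \<noteq> 0" using u ideal_setD(1)[OF id] by auto
  then have "p * r \<noteq> 0" using c(1) by (simp flip: r)
  then have nz: "r \<noteq> 0" "p \<noteq> 0" by auto
  have "\<not> good r"
  proof
    assume "good r"
    then obtain n v w where vw: "v \<notin> P" "w \<notin> P" "v * r = w * p ^ n" by (auto simp: good_def)
    have "(v * u) * c = v * (p * r)" by (simp add: mult.assoc r)
    also have "\<dots> = p * (v * r)" by (simp add: ac_simps)
    also have "\<dots> = w * p ^ Suc n" unfolding vw(3) by (simp add: ac_simps)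
    finally have "(v * u) * c = w * p ^ Suc n" .
    moreover have "v * u \<notin> P" using Pp vw u by blast
    ultimately have "good c" using vw(2) unfolding good_def by blast
    then show False using c by simp
  qed
  moreover have "L c \<subseteq> L r"
  proof
    fix x assume "x \<in> L c"
    then obtain v where v: "v \<notin> P" "c dvd v * x" by (auto simp: L_def)
    have "r dvd u * c" by (simp add: r)
    also have "u * c dvd u * (v * x)" using v(2) by (intro mult_dvd_mono) auto
    finally have "r dvd (u * v) * x" by (simp add: mult.assoc)
    moreover have "u * v \<notin> P" using Pp u v by blast
    ultimately show "x \<in> L r" by (auto simp: L_def)
  qed
  ultimately have "L r = L c" using max nz by blast
  moreover have "r \<in> L r" using P1 by (auto simp: L_def)
  ultimately obtain v where v: "v \<notin> P" "c dvd v * r" by (auto simp: L_def)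
  then obtain k where k: "v * r = c * k" by (auto elim: dvdE)
  have "r * (u * v) = u * (v * r)" by (simp add: ac_simps)
  also have "\<dots> = (u * c) * k" unfolding k by (simp add: ac_simps)
  also have "\<dots> = r * (k * p)" unfolding r by (simp add: ac_simps)
  finally have "u * v = k * p" using nz by simp
  then have "u * v \<in> P" using p ideal_setD(3)[OF id] by simp
  then show False using Pp u v by blast
qed

text \<open>
  Divisibility in the localization at \<open>P\<close> is a total preorder.
\<close>

lemma local_comparison:
  fixes P :: "'a::idom set"
  assumes D: "dedekind_domain TYPE('a)" and P: "prime_ideal_set P"
    and d: "d \<in> P" "d \<noteq> 0"
  shows "\<exists>u. u \<notin> P \<and> (a dvd u * b \<or> (b::'a) dvd u * a)"
proof -
  have noeth: "noetherian_domain (ring_of_type_algebra :: 'a ring)" using D by (simp add: dedekind_domain_def)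
  have P1: "1 \<notin> P" and Pp: "\<And>x y. x * y \<in> P \<Longrightarrow> x \<in> P \<or> y \<in> P" using P by (auto simp: prime_ideal_set_def)
  show ?thesis
  proof (cases "a = 0 \<or> b = 0")
    case False
    obtain p u where pu: "p \<in> P" "u \<notin> P" "\<And>q. q \<in> P \<Longrightarrow> p dvd u * q" using local_uniformizer[OF D P d] by blast
    have dir: "\<exists>u. u \<notin> P \<and> a dvd u * b" if "n \<le> l" "v \<notin> P" "w \<notin> P" "v * a = w * p ^ n" "v' \<notin> P" "w' \<notin> P" "v' * b = w' * p ^ l"
      for a b v w v' w' n l
    proof -
      have "(v' * w) * b = w * (v' * b)" by (simp add: ac_simps)
      also have "\<dots> = w * (w' * (p ^ n * p ^ (l - n)))" using that by (simp flip: power_add)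
      also have "\<dots> = w' * p ^ (l - n) * (w * p ^ n)" by (simp add: ac_simps)
      also have "\<dots> = a * (w' * p ^ (l - n) * v)" by (simp add: that(4)[symmetric] ac_simps)
      finally have "a dvd (v' * w) * b" by simp
      moreover have "v' * w \<notin> P" using Pp that by blast
      ultimately show ?thesis by blast
    qed
    obtain n v w where a: "v \<notin> P" "w \<notin> P" "v * a = w * p ^ n"
      using local_valuation[OF noeth P pu, of a] False by blast
    obtain l v' w' where b: "v' \<notin> P" "w' \<notin> P" "v' * b = w' * p ^ l"
      using local_valuation[OF noeth P pu, of b] False by blast
    show ?thesis using dir[OF _ a b] dir[OF _ b a] by (meson nat_le_linear)
  qed (use P1 in auto)
qed

lemma local_minimum:
  fixes P :: "'a::idom set"
  assumes D: "dedekind_domain TYPE('a)" and P: "prime_ideal_set P"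
    and d: "d \<in> P" "d \<noteq> 0" and A: "finite A" "A \<noteq> {}"
  shows "\<exists>c\<in>A. \<exists>u. u \<notin> P \<and> (\<forall>x\<in>A. (c::'a) dvd u * x)"
  using A
proof (induction A rule: finite_ne_induct)
  case (singleton x)
  have "1 \<notin> P" using P by (auto simp: prime_ideal_set_def)
  then show ?case by auto
next
  case (insert y A)
  have Pp: "\<And>x y. x * y \<in> P \<Longrightarrow> x \<in> P \<or> y \<in> P" and P1: "1 \<notin> P" using P by (auto simp: prime_ideal_set_def)
  obtain c u where c: "c \<in> A" "u \<notin> P" "\<And>x. x \<in> A \<Longrightarrow> c dvd u * x" using insert by blast
  obtain v where v: "v \<notin> P" "c dvd v * y \<or> y dvd v * c" using local_comparison[OF D P d, of c y] by blast
  have uv: "u * v \<notin> P" using Pp c v by blast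
  from v(2) show ?case
  proof
    assume "c dvd v * y"
    then have "c dvd (u * v) * y" by (simp only: mult.assoc) (rule dvd_mult)
    moreover have "c dvd (u * v) * x" if "x \<in> A" for x
      using dvd_mult[OF c(3)[OF that], of v] by (simp only: ac_simps)
    ultimately have "\<forall>x\<in>insert y A. c dvd (u * v) * x" by blast
    then show ?thesis using c(1) uv by blast
  next
    assume y: "y dvd v * c"
    have "y dvd (u * v) * x" if "x \<in> A" for x
    proof -
      have "v * c dvd v * (u * x)" using c(3)[OF that] by (intro mult_dvd_mono) auto
      with y have "y dvd v * (u * x)" by (rule dvd_trans)
      then show ?thesis by (simp only: ac_simps)
    qed
    then have "\<forall>x\<in>insert y A. y dvd (u * v) * x" by simp
    then show ?thesis using uv by blast
  qed
qed

section \<open>The largest content ideal\<close>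

definition content_ideal :: "'i set \<Rightarrow> ('i \<Rightarrow> 'a::comm_ring_1) \<Rightarrow> 'a set" where
  "content_ideal K c = range (\<lambda>r. \<Sum>\<mu>\<in>K. r \<mu> * c \<mu>)"

lemma content_ideal_ideal: "ideal_set (content_ideal K c)"
  unfolding ideal_set_def
proof (intro conjI ballI allI)
  show "0 \<in> content_ideal K c" by (auto simp: content_ideal_def intro!: range_eqI[of _ _ "\<lambda>_. 0"])
  fix y z assume "y \<in> content_ideal K c" "z \<in> content_ideal K c"
  then obtain r q where "y = (\<Sum>i\<in>K. r i * c i)" "z = (\<Sum>i\<in>K. q i * c i)" by (auto simp: content_ideal_def)
  then show "y + z \<in> content_ideal K c"
    by (auto simp: content_ideal_def sum.distrib algebra_simps intro!: range_eqI[of _ _ "\<lambda>i. r i + q i"])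
next
  fix y s assume "y \<in> content_ideal K c"
  then obtain r where "y = (\<Sum>i\<in>K. r i * c i)" by (auto simp: content_ideal_def)
  then show "s * y \<in> content_ideal K c"
    by (auto simp: content_ideal_def sum_distrib_left mult.assoc intro!: range_eqI[of _ _ "\<lambda>i. s * r i"])
qed

lemma content_ideal_generator:
  assumes "finite K" "\<mu> \<in> K"
  shows "c \<mu> \<in> content_ideal K c"
proof -
  have "c \<mu> = (\<Sum>\<nu>\<in>K. (if \<nu> = \<mu> then 1 else 0) * c \<nu>)"
    using assms by (simp add: if_distrib[of "\<lambda>x. x * _"] sum.delta cong: if_cong)
  then show ?thesis by (auto simp: content_ideal_def)
qed

lemma content_ideal_least:
  assumes "ideal_set I" "\<And>\<mu>. \<mu> \<in> K \<Longrightarrow> c \<mu> \<in> I"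
  shows "content_ideal K c \<subseteq> I"
  using assms by (auto simp: content_ideal_def intro!: ideal_set_sum ideal_setD(3))

text \<open>
  Here \<open>c \<mu> x\<close> may be thought of as the values at \<open>x\<close> of finitely many polynomials. Choose \<open>z\<close> with \<open>C(z)\<close> maximal and suppose
  that \<open>C(x)\<close> is not contained in it. At a prime \<open>P\<close> above the proper ideal \<open>C(z) : C(x)\<close> the two contents are
  comparable, so \<open>U C(z) \<subseteq> C(x)\<close> for some \<open>U\<close> outside \<open>P\<close>. With an idempotent \<open>g\<close> modulo \<open>d\<close> that is a
  multiple of \<open>U\<close> outside \<open>P\<close>, the point \<open>m = z + g (x - z)\<close> behaves like \<open>x\<close> where \<open>g\<close> is \<open>1\<close> and like \<open>z\<close>
  where \<open>g\<close> is \<open>0\<close>. Then \<open>C(m)\<close> contains \<open>C(z)\<close> and \<open>g C(x)\<close>, so by maximality \<open>g C(x) \<subseteq> C(z)\<close>, although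
  \<open>g\<close> is outside \<open>P\<close>.
\<close>

lemma largest_content:
  fixes c :: "'i \<Rightarrow> 'a::idom \<Rightarrow> 'a"
  assumes D: "dedekind_domain TYPE('a)" and K: "finite K" and d0: "d \<noteq> 0"
    and cong: "\<And>\<mu> x y. \<mu> \<in> K \<Longrightarrow> x - y dvd c \<mu> x - c \<mu> y"
    and d: "\<And>x. d \<in> content_ideal K (\<lambda>\<mu>. c \<mu> x)"
  obtains z where "\<And>x. content_ideal K (\<lambda>\<mu>. c \<mu> x) \<subseteq> content_ideal K (\<lambda>\<mu>. c \<mu> z)"
proof -
  have noeth: "noetherian_domain (ring_of_type_algebra :: 'a ring)" using D by (simp add: dedekind_domain_def)
  define C where "C x = content_ideal K (\<lambda>\<mu>. c \<mu> x)" for x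
  have CI: "ideal_set (C x)" for x unfolding C_def by (rule content_ideal_ideal)
  have gen: "c \<mu> x \<in> C x" if "\<mu> \<in> K" for \<mu> x
    unfolding C_def using content_ideal_generator[OF K that, of "\<lambda>\<mu>. c \<mu> x"] by simp
  have least: "C x \<subseteq> I" if "ideal_set I" "\<And>\<mu>. \<mu> \<in> K \<Longrightarrow> c \<mu> x \<in> I" for x I
    unfolding C_def by (rule content_ideal_least) (use that in auto)
  have dC: "y \<in> C x" if "d dvd y" for x y
    using ideal_set_dvd[OF CI _ that] d by (auto simp: C_def)
  have ne: "K \<noteq> {}" using d d0 by (auto simp: content_ideal_def)
  obtain M where M: "M \<in> range C" "\<And>J. J \<in> range C \<Longrightarrow> M \<subseteq> J \<Longrightarrow> J = M"
    by (rule noetherian_maximal[OF noeth, of "range C"]) (use CI in auto)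
  then obtain z where "M = C z" by blast
  then have max: "C x = C z" if "C z \<subseteq> C x" for x using M(2)[of "C x"] that by simp
  have "C x \<subseteq> C z" for x
  proof (rule ccontr)
    assume nsub: "\<not> C x \<subseteq> C z"
    define I where "I = {y. \<forall>\<mu>\<in>K. y * c \<mu> x \<in> C z}"
    have I_ideal: "ideal_set I"
      using ideal_setD[OF CI[of z]] by (auto simp: ideal_set_def I_def distrib_right mult.assoc)
    have "1 \<notin> I" using nsub least[OF CI, of x z] by (auto simp: I_def)
    then obtain P where P: "prime_ideal_set P" "I \<subseteq> P" using prime_ideal_above[OF noeth I_ideal, of "{1}"] by auto
    have id: "ideal_set P" and Pp: "\<And>x y. x * y \<in> P \<Longrightarrow> x \<in> P \<or> y \<in> P" and P1: "1 \<notin> P"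
      using P(1) by (auto simp: prime_ideal_set_def)
    have "d \<in> I" using dC by (auto simp: I_def)
    then have dP: "d \<in> P" using P(2) by auto
    obtain \<mu>0 u0 where m0: "\<mu>0 \<in> K" "u0 \<notin> P" "\<And>\<mu>. \<mu> \<in> K \<Longrightarrow> c \<mu>0 z dvd u0 * c \<mu> z"
      using local_minimum[OF D P(1) dP d0, of "(\<lambda>\<mu>. c \<mu> z) ` K"] K ne by auto
    obtain \<mu>1 u1 where m1: "\<mu>1 \<in> K" "u1 \<notin> P" "\<And>\<mu>. \<mu> \<in> K \<Longrightarrow> c \<mu>1 x dvd u1 * c \<mu> x"
      using local_minimum[OF D P(1) dP d0, of "(\<lambda>\<mu>. c \<mu> x) ` K"] K ne by auto
    obtain u where u: "u \<notin> P" "c \<mu>0 z dvd u * c \<mu>1 x \<or> c \<mu>1 x dvd u * c \<mu>0 z"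
      using local_comparison[OF D P(1) dP d0] by blast
    have not1: "\<not> c \<mu>0 z dvd u * c \<mu>1 x"
    proof
      assume *: "c \<mu>0 z dvd u * c \<mu>1 x"
      have "(u * u1) * c \<mu> x \<in> C z" if "\<mu> \<in> K" for \<mu>
      proof -
        have "u * c \<mu>1 x dvd u * (u1 * c \<mu> x)" using m1(3)[OF that] by (intro mult_dvd_mono) auto
        with * have "c \<mu>0 z dvd u * (u1 * c \<mu> x)" by (rule dvd_trans)
        then have "c \<mu>0 z dvd (u * u1) * c \<mu> x" by (simp only: mult.assoc)
        then show ?thesis using ideal_set_dvd[OF CI gen[OF m0(1)]] by blast
      qed
      then have "u * u1 \<in> P" using P(2) by (auto simp: I_def)
      then show False using Pp u(1) m1(2) by blast
    qed
    define U where "U = u * u0"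
    have "U \<notin> P" using Pp u(1) m0(2) by (auto simp: U_def)
    have Uz: "c \<mu>1 x dvd U * c \<mu> z" if "\<mu> \<in> K" for \<mu>
    proof -
      have "c \<mu>1 x dvd u * c \<mu>0 z" using u(2) not1 by blast
      also have "\<dots> dvd u * (u0 * c \<mu> z)" using m0(3)[OF that] by (intro mult_dvd_mono) auto
      finally show ?thesis by (simp add: U_def mult.assoc)
    qed
    obtain g where g: "U dvd g" "d dvd g * (1 - g)" "g \<notin> P"
      using idempotent_mod[OF D P(1) dP d0 \<open>U \<notin> P\<close>] by blast
    define m where "m = z + g * (x - z)"
    have gx: "g * c \<mu> x \<in> C m" if "\<mu> \<in> K" for \<mu>
    proof -
      have "d dvd g * (1 - g) * (z - x)" using g(2) by (rule dvd_mult2)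
      also have "g * (1 - g) * (z - x) = g * (m - x)" by (simp add: m_def algebra_simps)
      also have "g * (m - x) dvd g * (c \<mu> m - c \<mu> x)" using cong[OF that] by (intro mult_dvd_mono) auto
      finally have "g * (c \<mu> m - c \<mu> x) \<in> C m" by (rule dC)
      moreover have "g * c \<mu> m \<in> C m" using ideal_setD(3)[OF CI gen[OF that]] .
      ultimately have "g * c \<mu> m - g * (c \<mu> m - c \<mu> x) \<in> C m" using ideal_set_diff[OF CI] by blast
      then show ?thesis by (simp add: algebra_simps)
    qed
    have gz: "(1 - g) * c \<mu> z \<in> C m" if "\<mu> \<in> K" for \<mu>
    proof -
      have "g dvd m - z" by (simp add: m_def)
      then have "g dvd c \<mu> m - c \<mu> z" using cong[OF that] dvd_trans by blast
      then have "g * (1 - g) dvd (c \<mu> m - c \<mu> z) * (1 - g)" by (intro mult_dvd_mono) auto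
      then have "(c \<mu> m - c \<mu> z) * (1 - g) \<in> C m" using g(2) dC dvd_trans by blast
      moreover have "(1 - g) * c \<mu> m \<in> C m" using ideal_setD(3)[OF CI gen[OF that]] .
      ultimately have "(1 - g) * c \<mu> m - (c \<mu> m - c \<mu> z) * (1 - g) \<in> C m" using ideal_set_diff[OF CI] by blast
      then show ?thesis by (simp add: algebra_simps)
    qed
    have "C z \<subseteq> C m"
    proof (rule least[OF CI])
      fix \<mu> assume \<mu>: "\<mu> \<in> K"
      have "U * c \<mu> z dvd g * c \<mu> z" using g(1) by (intro mult_dvd_mono) auto
      then have "c \<mu>1 x dvd g * c \<mu> z" using Uz[OF \<mu>] dvd_trans by blast
      then have "g * c \<mu>1 x dvd g * (g * c \<mu> z)" by (intro mult_dvd_mono) auto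
      then have a: "g * (g * c \<mu> z) \<in> C m" using ideal_set_dvd[OF CI gx[OF m1(1)]] by blast
      have b: "g * (1 - g) * c \<mu> z \<in> C m" using dC g(2) dvd_mult2 by blast
      have "c \<mu> z = (1 - g) * c \<mu> z + (g * (g * c \<mu> z) + g * (1 - g) * c \<mu> z)" by (simp add: algebra_simps)
      also have "\<dots> \<in> C m" using gz[OF \<mu>] a b by (intro ideal_setD(2)[OF CI])
      finally show "c \<mu> z \<in> C m" .
    qed
    then have "C m = C z" by (rule max)
    then have "g \<in> I" using gx by (auto simp: I_def)
    then show False using P(2) g(3) by blast
  qed
  then show thesis using that[of z] by (auto simp: C_def)
qed

section \<open>The Hilbert-Schinzel specialization property\<close>

lemma specialize_cong: "(\<And>i. i < k \<Longrightarrow> m i = m' i) \<Longrightarrow> specialize k m p = specialize k m' p"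
  unfolding specialize_conv by (rule mp_eval_cong) auto

lemma eval_mpoly_cong: "(\<And>i. i \<in> mpoly_vars p \<Longrightarrow> m i = m' i) \<Longrightarrow> eval_mpoly m p = eval_mpoly m' p"
  unfolding eval_mpoly_conv by (rule mp_eval_cong) auto

lemma mpoly_vars_specialize:
  assumes "mpoly_vars p \<subseteq> {..<k + n}"
  shows "mpoly_vars (specialize k m p) \<subseteq> {k..<k + n}"
  unfolding specialize_conv using assms
  by (intro mpoly_vars_mp_eval) (auto simp: mpoly_vars_var)

text \<open>
  The set of all good points is Zariski-dense as soon as every nonzero \<open>F\<close> is nonzero at a good point. The
  points here are arbitrary functions; only their first \<open>k\<close> values matter.
\<close>

lemma hilbert_schinzelI:
  fixes k n s :: nat
  assumes "\<And>(R :: nat \<Rightarrow> 'z::idom mpoly) (F :: 'z fract mpoly).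
      (\<And>i. i < s \<Longrightarrow> mpoly_vars (R i) \<subseteq> {..<k + n}) \<Longrightarrow>
      (\<And>i. i < s \<Longrightarrow> Factorial_Ring.irreducible (fract_mpoly (R i))) \<Longrightarrow>
      (\<And>i. i < s \<Longrightarrow> \<not> mpoly_vars (R i) \<subseteq> {..<k}) \<Longrightarrow>
      (\<And>a. \<not> fixed_divisor k (\<Prod>i<s. R i) a) \<Longrightarrow>
      F \<noteq> 0 \<Longrightarrow> mpoly_vars F \<subseteq> {..<k} \<Longrightarrow>
      \<exists>m. (\<forall>i<s. Factorial_Ring.irreducible (fract_mpoly (specialize k m (R i))) \<and>
                 primitive_mpoly (specialize k m (R i))) \<and>
          eval_mpoly (\<lambda>j. to_fract (m j)) F \<noteq> 0"
  shows "hilbert_schinzel TYPE('z) k n s"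
  unfolding hilbert_schinzel_def
proof (intro allI impI)
  fix R :: "nat \<Rightarrow> 'z mpoly"
  assume R: "\<forall>i<s. R i \<in> carrier (mpoly_ring {..<k + n}) \<and>
               ring_irreducible\<^bsub>mpoly_ring {..<k + n}\<^esub> (fract_mpoly (R i)) \<and>
               primitive_mpoly (R i) \<and> 1 \<le> degree_y k (R i)"
    and nofix: "\<not> (\<exists>a. fixed_divisor k (\<Prod>i<s. R i) a)"
  have vars: "mpoly_vars (R i) \<subseteq> {..<k + n}" if "i < s" for i
    using R that by (auto simp: carrier_mpoly_ring)
  have irr: "Factorial_Ring.irreducible (fract_mpoly (R i))" if "i < s" for i
    using R that vars[OF that] ring_irreducible_mpoly_ring[of "fract_mpoly (R i)" "{..<k + n}"] by auto
  have high: "\<not> mpoly_vars (R i) \<subseteq> {..<k}" if "i < s" for i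
    using R that by (simp flip: degree_y_ge_1)
  define good where "good m \<longleftrightarrow> (\<forall>i<s.
      ring_irreducible\<^bsub>mpoly_ring {k..<k + n}\<^esub> (fract_mpoly (specialize k m (R i))) \<and>
      primitive_mpoly (specialize k m (R i)))" for m
  have "zariski_dense k {m \<in> tuples k. good m}"
    unfolding zariski_dense_def
  proof (intro conjI notI)
    assume "\<exists>F\<in>carrier (mpoly_ring {..<k}) :: 'z fract mpoly set.
        F \<noteq> 0 \<and> (\<forall>m\<in>{m \<in> tuples k. good m}. eval_mpoly (\<lambda>j. to_fract (m j)) F = 0)"
    then obtain F :: "'z fract mpoly" where F: "mpoly_vars F \<subseteq> {..<k}" "F \<noteq> 0"
      and zero: "\<And>m. m \<in> tuples k \<Longrightarrow> good m \<Longrightarrow> eval_mpoly (\<lambda>j. to_fract (m j)) F = 0"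
      by (auto simp: carrier_mpoly_ring)
    have "\<exists>m. (\<forall>i<s. Factorial_Ring.irreducible (fract_mpoly (specialize k m (R i))) \<and>
                 primitive_mpoly (specialize k m (R i))) \<and>
          eval_mpoly (\<lambda>j. to_fract (m j)) F \<noteq> 0"
      by (rule assms[of R F]) (use vars irr high nofix F in blast)+
    then obtain m where m: "\<And>i. i < s \<Longrightarrow> Factorial_Ring.irreducible (fract_mpoly (specialize k m (R i)))"
      "\<And>i. i < s \<Longrightarrow> primitive_mpoly (specialize k m (R i))"
      "eval_mpoly (\<lambda>j. to_fract (m j)) F \<noteq> 0" by blast
    define m' where "m' = restrict m {..<k}"
    have sp: "specialize k m' p = specialize k m p" for p :: "'z mpoly"
      by (rule specialize_cong) (simp add: m'_def)
    have "good m'"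
      unfolding good_def sp
    proof (intro allI impI conjI)
      fix i assume i: "i < s"
      show "ring_irreducible\<^bsub>mpoly_ring {k..<k + n}\<^esub> (fract_mpoly (specialize k m (R i)))"
        using ring_irreducible_mpoly_ring[of "fract_mpoly (specialize k m (R i))" "{k..<k + n}"]
          m(1)[OF i] mpoly_vars_specialize[OF vars[OF i], of m] by simp
    qed (rule m(2))
    moreover have "m' \<in> tuples k" by (simp add: m'_def tuples_def)
    ultimately have "eval_mpoly (\<lambda>j. to_fract (m' j)) F = 0" by (intro zero)
    moreover have "eval_mpoly (\<lambda>j. to_fract (m' j)) F = eval_mpoly (\<lambda>j. to_fract (m j)) F"
      by (rule eval_mpoly_cong) (use F(1) in \<open>auto simp: m'_def\<close>)
    ultimately show False using m(3) by simp
  qed auto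
  moreover have "\<forall>m\<in>{m \<in> tuples k. good m}. \<forall>i<s.
      ring_irreducible\<^bsub>mpoly_ring {k..<k + n}\<^esub> (fract_mpoly (specialize k m (R i))) \<and>
      primitive_mpoly (specialize k m (R i))"
    by (simp add: good_def)
  ultimately show "\<exists>H. zariski_dense k H \<and> (\<forall>m\<in>H. \<forall>i<s.
      ring_irreducible\<^bsub>mpoly_ring {k..<k + n}\<^esub> (fract_mpoly (specialize k m (R i))) \<and>
      primitive_mpoly (specialize k m (R i)))"
    by blast
qed

lemma const_dvd_specialize_prod:
  fixes R :: "nat \<Rightarrow> 'a::comm_ring_1 mpoly"
  assumes "i < s" "const_mpoly d dvd specialize k m (R i)"
  shows "const_mpoly d dvd specialize k m (\<Prod>i<s. R i)"
  unfolding is_ring_hom_prod[OF is_ring_hom_specialize]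
  using assms(2) by (rule dvd_trans) (use assms(1) in \<open>auto intro: dvd_prodI\<close>)

lemma hilbert_schinzel_near_ufd:
  assumes hilb: "hilbertian_ring TYPE('z::idom)" and nu: "near_ufd TYPE('z)" and n: "1 \<le> n" and s: "1 \<le> s"
  shows "hilbert_schinzel TYPE('z) k n s"
proof (rule hilbert_schinzelI)
  fix R :: "nat \<Rightarrow> 'z mpoly" and F :: "'z fract mpoly"
  assume vars: "\<And>i. i < s \<Longrightarrow> mpoly_vars (R i) \<subseteq> {..<k + n}"
    and irr: "\<And>i. i < s \<Longrightarrow> Factorial_Ring.irreducible (fract_mpoly (R i))"
    and high: "\<And>i. i < s \<Longrightarrow> \<not> mpoly_vars (R i) \<subseteq> {..<k}"
    and nofix: "\<And>a. \<not> fixed_divisor k (\<Prod>i<s. R i) a"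
    and F: "F \<noteq> 0" "mpoly_vars F \<subseteq> {..<k}"
  have np: "\<exists>m. \<not> const_mpoly p dvd specialize k m (\<Prod>i<s. R i)" if "prime_elem p" for p
    using nofix[of p] that by (auto simp: fixed_divisor_def const_dvd_iff prime_elem_def)
  obtain m where m: "\<And>i. i < s \<Longrightarrow> Factorial_Ring.irreducible (fract_mpoly (specialize k m (R i)))"
    "\<And>p. prime_elem p \<Longrightarrow> \<not> const_mpoly p dvd specialize k m (\<Prod>i<s. R i)"
    "eval_mpoly (\<lambda>i. to_fract (m i)) F \<noteq> 0"
    using near_ufd_specialization[OF hilb nu s, of k "k + n" 0 R F] vars irr high np F n
    by (auto simp: atLeast0LessThan)
  have "primitive_mpoly (specialize k m (R i))" if i: "i < s" for i
    unfolding primitive_mpoly_def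
  proof (intro allI impI, rule ccontr)
    fix d assume d: "\<forall>\<mu>. d dvd Poly_Mapping.lookup (specialize k m (R i)) \<mu>" "\<not> d dvd 1"
    then obtain p where p: "prime_elem p" "p dvd d" using nu unfolding near_ufd_def by blast
    have "const_mpoly p dvd specialize k m (R i)" using d(1) p(2) by (auto simp: const_dvd_iff intro: dvd_trans)
    then show False using m(2)[OF p(1)] const_dvd_specialize_prod[OF i] by blast
  qed
  then show "\<exists>m. (\<forall>i<s. Factorial_Ring.irreducible (fract_mpoly (specialize k m (R i))) \<and>
                 primitive_mpoly (specialize k m (R i))) \<and>
          eval_mpoly (\<lambda>j. to_fract (m j)) F \<noteq> 0"
    using m by blast
qed

lemma specialize_1: "specialize 1 m p = specialize_var 0 (m 0) p"
  unfolding specialize_conv specialize_var_def by (rule mp_eval_cong) auto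

lemma hilbert_schinzel_dedekind:
  assumes hilb: "hilbertian_ring TYPE('z::idom)" and D: "dedekind_domain TYPE('z)" and n: "1 \<le> n" and s: "1 \<le> s"
  shows "hilbert_schinzel TYPE('z) 1 n s"
proof (rule hilbert_schinzelI)
  fix R :: "nat \<Rightarrow> 'z mpoly" and F :: "'z fract mpoly"
  assume vars: "\<And>i. i < s \<Longrightarrow> mpoly_vars (R i) \<subseteq> {..<1 + n}"
    and irr: "\<And>i. i < s \<Longrightarrow> Factorial_Ring.irreducible (fract_mpoly (R i))"
    and high0: "\<And>i. i < s \<Longrightarrow> \<not> mpoly_vars (R i) \<subseteq> {..<1}"
    and nofix: "\<And>a. \<not> fixed_divisor 1 (\<Prod>i<s. R i) a"
    and F: "F \<noteq> 0" "mpoly_vars F \<subseteq> {..<1}"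
  define G where "G = (\<Prod>i<s. R i)"
  have high: "\<not> mpoly_vars (R i) \<subseteq> {..0}" if "i < s" for i using high0[OF that] by (simp add: lessThan_Suc_atMost)
  obtain d V where d: "d \<noteq> 0" "\<And>m. d = (\<Sum>\<mu>\<in>Poly_Mapping.keys (poly_in 0 (\<Prod>i<s. R i)). poly (V \<mu>) m * Poly_Mapping.lookup (specialize_var 0 m (\<Prod>i<s. R i)) \<mu>)"
    by (rule content_contains_constant[of s R 0, OF irr high]) (assumption | rule that)+
  note d = d[folded G_def]
  define K where "K = Poly_Mapping.keys (poly_in 0 G)"
  define C where "C x = content_ideal K (\<lambda>\<mu>. Poly_Mapping.lookup (specialize_var 0 x G) \<mu>)" for x
  have Cd: "d \<in> C x" for x unfolding C_def content_ideal_def K_def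
    by (rule range_eqI[of _ _ "\<lambda>\<mu>. poly (V \<mu>) x"]) (rule d(2))
  obtain z where z: "\<And>x. C x \<subseteq> C z"
    unfolding C_def
  proof (rule largest_content[OF D, of K d "\<lambda>\<mu> x. Poly_Mapping.lookup (specialize_var 0 x G) \<mu>"])
    show "x - y dvd Poly_Mapping.lookup (specialize_var 0 x G) \<mu> - Poly_Mapping.lookup (specialize_var 0 y G) \<mu>" for \<mu> x y
      unfolding lookup_specialize_var by (rule poly_diff_dvd)
  qed (use d(1) Cd that in \<open>auto simp: K_def C_def\<close>)
  have C_cong: "C z \<subseteq> C x" if "d dvd x - z" for x
    unfolding C_def[of z]
  proof (rule content_ideal_least)
    show id: "ideal_set (C x)" unfolding C_def by (rule content_ideal_ideal)
    fix \<mu> assume \<mu>: "\<mu> \<in> K"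
    let ?f = "Poly_Mapping.lookup (poly_in 0 G) \<mu>"
    have "d dvd poly ?f x - poly ?f z" using that poly_diff_dvd by (rule dvd_trans)
    then have "poly ?f x - poly ?f z \<in> C x" using ideal_set_dvd[OF id Cd] by blast
    moreover have "Poly_Mapping.lookup (specialize_var 0 x G) \<mu> \<in> C x"
      unfolding C_def by (rule content_ideal_generator[OF _ \<mu>]) (simp add: K_def)
    then have "poly ?f x \<in> C x" by (simp add: lookup_specialize_var)
    ultimately have "poly ?f x - (poly ?f x - poly ?f z) \<in> C x" by (simp only: ideal_set_diff[OF id])
    then show "Poly_Mapping.lookup (specialize_var 0 z G) \<mu> \<in> C x" by (simp add: lookup_specialize_var)
  qed
  obtain \<kappa> where \<kappa>: "\<kappa> \<in> Poly_Mapping.keys (poly_in 0 F)" using poly_in_nonzero[OF F(1), of 0] by (metis keys_eq_empty equals0I)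
  then have f: "Poly_Mapping.lookup (poly_in 0 F) \<kappa> \<noteq> 0" by (simp add: in_keys_iff)
  have N: "Suc 0 < 1 + n" using n by simp
  have vars': "mpoly_vars (R i) \<subseteq> {0..<1 + n}" if "i < s" for i using vars[OF that] by auto
  obtain x where x: "d dvd x - z" "poly (Poly_Mapping.lookup (poly_in 0 F) \<kappa>) (to_fract x) \<noteq> 0"
    "\<And>i. i < s \<Longrightarrow> Factorial_Ring.irreducible (fract_mpoly (specialize_var 0 x (R i)))"
    by (rule hilbertian_progression[where R = R and z = z, OF hilb s N _ _ _ f d(1)])
      (assumption | rule vars' irr high that)+
  define m where "m = (\<lambda>_ :: nat. x)"
  have sp: "specialize 1 m p = specialize_var 0 x p" for p :: "'z mpoly" by (simp only: specialize_1 m_def)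
  have "primitive_mpoly (specialize 1 m (R i))" if i: "i < s" for i
    unfolding primitive_mpoly_def
  proof (intro allI impI, rule ccontr)
    fix e assume e: "\<forall>\<mu>. e dvd Poly_Mapping.lookup (specialize 1 m (R i)) \<mu>" "\<not> e dvd 1"
    have "specialize 1 m (R i) \<noteq> 0"
      using x(3)[OF i] unfolding sp by (auto simp: is_ring_homD[OF is_ring_hom_map[OF is_ring_hom_to_fract]])
    moreover have "specialize 1 m (R i) = 0" if "e = 0"
      by (rule poly_mapping_eqI) (use e(1) that in simp)
    ultimately have "e \<noteq> 0" by blast
    have "const_mpoly e dvd specialize 1 m G"
      unfolding G_def by (rule const_dvd_specialize_prod[where R = R, OF i e(1)[folded const_dvd_iff]])
    then have "C x \<subseteq> {y. e dvd y}"
      unfolding C_def sp by (intro content_ideal_least) (auto simp: const_dvd_iff ideal_set_def)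
    then have all: "C y \<subseteq> {y. e dvd y}" for y using C_cong[OF x(1)] z[of y] by blast
    have "e dvd Poly_Mapping.lookup (specialize_var 0 y G) \<mu>" for y \<mu>
    proof (cases "\<mu> \<in> K")
      case True
      then have "Poly_Mapping.lookup (specialize_var 0 y G) \<mu> \<in> C y"
        unfolding C_def by (intro content_ideal_generator) (simp_all add: K_def)
      then show ?thesis using all by blast
    qed (simp add: K_def lookup_specialize_var in_keys_iff)
    then have "fixed_divisor 1 G e"
      using e(2) \<open>e \<noteq> 0\<close> unfolding fixed_divisor_def specialize_1 by blast
    then show False using nofix G_def by simp
  qed
  moreover have "eval_mpoly (\<lambda>j. to_fract (m j)) F \<noteq> 0"
  proof -
    have "mpoly_vars (specialize_var 0 (to_fract x) F) = {}" using mpoly_vars_specialize_var[of 0 "to_fract x" F] F(2) by auto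
    then obtain c where c: "specialize_var 0 (to_fract x) F = const_mpoly c" using mpoly_no_vars by blast
    have "c \<noteq> 0"
    proof
      assume "c = 0"
      then have "Poly_Mapping.lookup (specialize_var 0 (to_fract x) F) \<kappa> = 0" by (simp add: c)
      then show False using x(2) by (simp add: lookup_specialize_var)
    qed
    moreover have "eval_mpoly (\<lambda>j. to_fract (m j)) (specialize_var 0 (to_fract x) F) = c"
      unfolding c eval_mpoly_conv by (rule mp_eval_const[OF is_ring_hom_id])
    moreover have "(\<lambda>j. to_fract (m j))(0 := to_fract x) = (\<lambda>j. to_fract (m j))" by (auto simp: m_def)
    ultimately show ?thesis by (simp add: eval_mpoly_specialize_var)
  qed
  ultimately show "\<exists>m. (\<forall>i<s. Factorial_Ring.irreducible (fract_mpoly (specialize 1 m (R i))) \<and>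
                 primitive_mpoly (specialize 1 m (R i))) \<and>
          eval_mpoly (\<lambda>j. to_fract (m j)) F \<noteq> 0"
    using x(3) sp by (intro exI[of _ m]) simp
qed

theorem theorem1p6:
  assumes "hilbertian_ring TYPE('z::idom)"
  shows "(near_ufd TYPE('z) \<longrightarrow>
            (\<forall>k n s. 1 \<le> k \<longrightarrow> 1 \<le> n \<longrightarrow> 1 \<le> s \<longrightarrow> hilbert_schinzel TYPE('z) k n s)) \<and>
         (dedekind_domain TYPE('z) \<longrightarrow>
            (\<forall>n s. 1 \<le> n \<longrightarrow> 1 \<le> s \<longrightarrow> hilbert_schinzel TYPE('z) 1 n s))"
  using hilbert_schinzel_near_ufd[OF assms] hilbert_schinzel_dedekind[OF assms] by blast

end
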